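(* Let $\mathcal{S},\mathcal{T}\subseteq\mathbb{C}^n$ be subspaces and let $X$ be a Hermitian $n\times n$ complex matrix such that $e^{iX}\mathcal{S}=\mathcal{T}$. Then $$\Theta(\mathcal{S},\mathcal{T})\prec_w \tfrac12\,\mathrm{Spr}^+(X).$$
   Context: For a Hermitian $n\times n$ complex matrix $A$, $\lambda(A)=(\lambda_1(A),\dots,\lambda_n(A))$ denotes its eigenvalues, counted with multiplicity, in non-increasing order. The spectral spread of $A$ is $\mathrm{Spr}^+(A)=(\lambda_i(A)-\lambda_{n-i+1}(A))_{1\le i\le [n/2]}\in\mathbb{R}_{\ge 0}^{[n/2]}$, where $[\cdot]$ is the integer part. For a complex matrix $C$, $s(C)=\lambda((C^*C)^{1/2})$ is the vector of singular values in non-increasing order. Principal angles: if $\mathcal{S},\mathcal{T}\subseteq\mathbb{C}^n$ are $k$-dimensional subspaces and $S,T$ are $n\times k$ isometries ($S^*S=T^*T=I_k$) with ranges $\mathcal{S}$ and $\mathcal{T}$, then $\Theta(\mathcal{S},\mathcal{T})=(\theta_j)_{1\le j\le k}\in[0,\pi/2]^k$ is the non-increasing vector defined by $\cos(\theta_j)=s_{k-j+1}(S^*T)$ for $1\le j\le k$. (The subspaces in the claim have the same dimension $k$, since $e^{iX}$ is unitary.) Submajorization: for $x,y\in\mathbb{R}^m$, $x\prec_w y$ means $\sum_{i=1}^j x_i^{\downarrow}\le\sum_{i=1}^j y_i^{\downarrow}$ for all $1\le j\le m$, where $x^{\downarrow}$ is the non-increasing rearrangement of $x$. If $x,y$ have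 non-negative entries and different lengths, $x\prec_w y$ means the relation holds after appending zeros to the shorter vector to equalize lengths. *)

theory Defs
  imports Complex_Main "Jordan_Normal_Form.Schur_Decomposition"
begin

definition hermitian_mat :: "nat \<Rightarrow> complex mat \<Rightarrow> bool" where
  "hermitian_mat n A \<longleftrightarrow> A \<in> carrier_mat n n \<and> mat_adjoint A = A"

text \<open>Eigenvalues with algebraic multiplicity, in non-increasing order. Only meant for matrices
  with real spectrum (e.g. Hermitian ones), where \<^const>\<open>Re\<close> merely converts the type.
  Indices of lists start at 0.\<close>
definition eigvals_desc :: "complex mat \<Rightarrow> real list" where
  "eigvals_desc A = rev (sorted_list_of_multiset (image_mset Re (proots (char_poly A))))"

text \<open>With 0-based indices, the partner of index \<open>i\<close> is \<open>n - 1 - i\<close>.\<close>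
definition spectral_spread :: "complex mat \<Rightarrow> real list" where
  "spectral_spread A = (let n = dim_row A; l = eigvals_desc A in
     map (\<lambda>i. l ! i - l ! (n - 1 - i)) [0..<n div 2])"

text \<open>For Hermitian \<open>A\<close> the quadratic form is real, so taking the real part loses nothing.\<close>
definition psd_mat :: "nat \<Rightarrow> complex mat \<Rightarrow> bool" where
  "psd_mat n A \<longleftrightarrow> hermitian_mat n A \<and> (\<forall>v\<in>carrier_vec n. 0 \<le> Re ((A *\<^sub>v v) \<bullet>c v))"

text \<open>The unique positive semidefinite square root of a positive semidefinite matrix.\<close>
definition mat_sqrt :: "complex mat \<Rightarrow> complex mat" where
  "mat_sqrt A = (THE B. psd_mat (dim_row A) B \<and> B * B = A)"

definition sing_vals :: "complex mat \<Rightarrow> real list" where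
  "sing_vals C = eigvals_desc (mat_sqrt (mat_adjoint C * C))"

text \<open>The matrix exponential, as its (entrywise convergent) power series.\<close>
definition mat_exp :: "complex mat \<Rightarrow> complex mat" where
  "mat_exp A = mat (dim_row A) (dim_row A) (\<lambda>(i, j). \<Sum>k. (A ^\<^sub>m k) $$ (i, j) / fact k)"

definition mat_range :: "complex mat \<Rightarrow> complex vec set" where
  "mat_range A = (\<lambda>v. A *\<^sub>v v) ` carrier_vec (dim_col A)"

text \<open>\<open>A\<close> is an \<open>n \<times> k\<close> isometry with range \<open>W\<close>; necessarily \<open>k\<close> is the dimension of \<open>W\<close>.\<close>
definition isometry_onto :: "nat \<Rightarrow> complex vec set \<Rightarrow> complex mat \<Rightarrow> bool" where
  "isometry_onto n W A \<longleftrightarrow>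
     dim_row A = n \<and> mat_adjoint A * A = 1\<^sub>m (dim_col A) \<and> mat_range A = W"

text \<open>The principal angles between two subspaces of \<open>\<complex>\<^sup>n\<close> of equal dimension \<open>k\<close>. The \<open>j\<close>-th
  angle is the one in \<open>[0, \<pi>/2]\<close> whose cosine is the \<open>(k-j+1)\<close>-th singular value, whence the
  reversal. The result does not depend on the isometries chosen: other choices multiply
  the matrix \<open>A\<^sup>* B\<close> by unitary matrices from both sides.\<close>
definition principal_angles :: "nat \<Rightarrow> complex vec set \<Rightarrow> complex vec set \<Rightarrow> real list" where
  "principal_angles n S T =
     (let A = (SOME A. isometry_onto n S A); B = (SOME B. isometry_onto n T B)
      in map arccos (rev (sing_vals (mat_adjoint A * B))))"

definition pad_zeros :: "nat \<Rightarrow> real list \<Rightarrow> real list" where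
  "pad_zeros m x = x @ replicate (m - length x) 0"

text \<open>For lists of different lengths this is intended for non-negative entries only.\<close>
definition submajorized :: "real list \<Rightarrow> real list \<Rightarrow> bool"  (infix \<open>\<prec>\<^sub>w\<close> 50) where
  "x \<prec>\<^sub>w y \<longleftrightarrow> (let m = max (length x) (length y) in
     \<forall>j\<in>{1..m}. sum_list (take j (rev (sort (pad_zeros m x))))
              \<le> sum_list (take j (rev (sort (pad_zeros m y)))))"

end

theory Submission
  imports "HOL-Complex_Analysis.Complex_Analysis" Defs
begin

text \<open>
  Move the subspace continuously: for real \<open>t\<close> put \<open>T(t) = e\<^sup>i\<^sup>t\<^sup>X S\<close>, and let \<open>f(t)\<close> be the sum of the
  \<open>r\<close> largest principal angles between \<open>S\<close> and \<open>T(t)\<close>. Since \<open>f(0) = 0\<close>, it suffices that \<open>f\<close> never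
  grows faster than half the sum of the \<open>r\<close> largest entries of the spectral spread.

  Fix \<open>t\<close> and let \<open>b\<^sub>1, b\<^sub>2, \<dots>\<close> be principal vectors of \<open>T(t)\<close>, that is
  \<open>b\<^sub>i = cos \<theta>\<^sub>i p\<^sub>i + sin \<theta>\<^sub>i c\<^sub>i\<close> with \<open>p\<^sub>i\<close> in \<open>S\<close>, \<open>c\<^sub>i\<close> orthogonal to \<open>S\<close>, where for angles
  strictly between \<open>0\<close> and \<open>\<pi>/2\<close> all the \<open>p\<^sub>i\<close> and \<open>c\<^sub>i\<close> are orthonormal. Then \<open>\<langle>b\<^sub>i, c\<^sub>i\<rangle> = sin \<theta>\<^sub>i\<close>. At any other time \<open>s\<close> the rotated vectors
  \<open>e\<^sup>i\<^sup>(\<^sup>s\<^sup>-\<^sup>t\<^sup>)\<^sup>X b\<^sub>i\<close> lie in \<open>T(s)\<close>, and convexity of the arcsine on \<open>[0,1]\<close> together with Bessel's inequality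
  gives \<open>\<Sum> arcsin (Re \<langle>e\<^sup>i\<^sup>(\<^sup>s\<^sup>-\<^sup>t\<^sup>)\<^sup>X b\<^sub>i, c\<^sub>i\<rangle>) \<le> f(s)\<close>, with equality at \<open>s = t\<close>
  (\<open>sum_arcsin_le\<close>). So at each \<open>t\<close> the function \<open>f\<close> is touched from below by an explicit function
  \<open>G\<close>. No eigenvalue has to be differentiated, so multiplicities cause no trouble.

  If all \<open>\<theta>\<^sub>i < \<pi>/2\<close>, then \<open>G\<close> is differentiable at \<open>t\<close> with
  \<open>G'(t) = - \<Sum> Im \<langle>X p\<^sub>i, c\<^sub>i\<rangle>\<close>. Polarization with the orthonormal vectors \<open>(p\<^sub>i \<plusminus> \<i> c\<^sub>i)/\<surd>2\<close> and Ky Fan's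
  principle bound this by \<open>\<onehalf> \<Sum> (\<lambda>\<^sub>i - \<lambda>\<^sub>n\<^sub>-\<^sub>i\<^sub>+\<^sub>1)\<close> (\<open>paired_form_le\<close>). A right angle at time \<open>t\<close> forces the
  determinant of the compression of \<open>e\<^sup>i\<^sup>t\<^sup>X\<close> to \<open>S\<close> to vanish. That determinant is an entire function of
  \<open>t\<close> with value \<open>1\<close> at \<open>0\<close>, so this happens at countably many times only
  (\<open>countable_singular_times\<close>). The same touching functions show that \<open>f\<close> is continuous, and a
  continuous function which off a countable set is touched from below with slope at most \<open>c\<close> grows
  by at most \<open>c\<close> on the unit interval (\<open>le_of_lower_touching\<close>).

  The computation takes place in coordinates with respect to an eigenbasis of \<open>X\<close>, where \<open>e\<^sup>i\<^sup>t\<^sup>X\<close> acts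
  diagonally. The rest is the dictionary between these vectors and matrices: the spectral theorem for
  Hermitian matrices and the uniqueness of positive square roots identify the squared cosines of the
  principal angles with the eigenvalues of a Gram matrix.
\<close>

section \<open>Functions touched from below with bounded slope\<close>

text \<open>
  Subtract a linear function of slope slightly above \<open>c\<close>, giving
  \<open>\<phi>\<close>. If \<open>\<phi> 0 < \<phi> 1\<close>, then some level
  \<open>\<gamma>\<close> in between is attained by \<open>\<phi>\<close> at no point of the
  countable set \<open>E\<close>. At the first time \<open>\<phi>\<close> reaches
  \<open>\<gamma>\<close>, the touching function is strictly decreasing, so
  \<open>\<phi>\<close> exceeded \<open>\<gamma>\<close> just before: a contradiction.
\<close>

lemma le_of_lower_touching:
  fixes f :: "real \<Rightarrow> real"
  assumes cont: "continuous_on {0..1} f" and E: "countable E"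
    and touch: "\<And>t. 0 < t \<Longrightarrow> t \<le> 1 \<Longrightarrow> t \<notin> E \<Longrightarrow>
      \<exists>G G'. (G has_real_derivative G') (at t) \<and> G t = f t \<and> G' \<le> c \<and> (\<forall>s. G s \<le> f s)"
  shows "f 1 \<le> f 0 + c"
proof (rule field_le_epsilon)
  fix \<eta> :: real assume \<eta>: "\<eta> > 0"
  define \<phi> where "\<phi> t = f t - (c + \<eta>) * t" for t
  have cont\<phi>: "continuous_on {0..1} \<phi>"
    unfolding \<phi>_def by (intro continuous_intros cont)
  have "\<phi> 1 \<le> \<phi> 0"
  proof (rule ccontr)
    assume "\<not> \<phi> 1 \<le> \<phi> 0"
    hence "uncountable {\<phi> 0<..<\<phi> 1}" by (intro uncountable_open_interval[THEN iffD2]) simp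
    moreover have "countable (\<phi> ` E)" using E by simp
    ultimately have "\<not> {\<phi> 0<..<\<phi> 1} \<subseteq> \<phi> ` E" using countable_subset by blast
    then obtain \<gamma> where "\<gamma> \<in> {\<phi> 0<..<\<phi> 1}" "\<gamma> \<notin> \<phi> ` E" by blast
    hence \<gamma>: "\<phi> 0 < \<gamma>" "\<gamma> < \<phi> 1" "\<gamma> \<notin> \<phi> ` E" by simp_all
    \<comment> \<open>the least element of \<open>K\<close> is the first time at which the level \<open>\<gamma>\<close> is reached\<close>
    define K where "K = {0..1} \<inter> \<phi> -` {\<gamma>..}"
    have "closed K" unfolding K_def
      by (rule continuous_closed_preimage[OF cont\<phi>]) auto
    hence "compact K" unfolding K_def
      by (metis K_def bounded_Int bounded_closed_interval compact_eq_bounded_closed)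
    moreover have "1 \<in> K" using \<gamma> by (simp add: K_def)
    ultimately obtain t0 where t0: "t0 \<in> K" "\<And>t. t \<in> K \<Longrightarrow> t0 \<le> t"
      using compact_attains_inf[of K] by blast
    have t0b: "0 \<le> t0" "t0 \<le> 1" "\<gamma> \<le> \<phi> t0" using t0 by (auto simp: K_def)
    have "t0 \<noteq> 0" using t0b \<gamma> by auto
    hence t0pos: "0 < t0" using t0b by simp
    have below: "\<phi> t < \<gamma>" if "0 \<le> t" "t < t0" for t
      using t0(2)[of t] that t0b by (force simp: K_def)
    have "\<exists>t\<ge>0. t \<le> t0 \<and> \<phi> t = \<gamma>"
      by (rule IVT') (use \<gamma> t0b in \<open>auto intro: continuous_on_subset[OF cont\<phi>]\<close>)
    then obtain t where "0 \<le> t" "t \<le> t0" "\<phi> t = \<gamma>" by auto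
    hence eq: "\<phi> t0 = \<gamma>" using below[of t] by (cases "t = t0") auto
    hence "t0 \<notin> E" using \<gamma> by auto
    from touch[OF t0pos t0b(2) this] obtain G G' where
      G: "(G has_real_derivative G') (at t0)" "G t0 = f t0" "G' \<le> c" "\<And>s. G s \<le> f s" by blast
    have d: "((\<lambda>s. G s - (c + \<eta>) * s) has_real_derivative (G' - (c + \<eta>))) (at t0)"
      by (rule derivative_eq_intros G refl | simp)+
    have "G' - (c + \<eta>) < 0" using G \<eta> by simp
    from DERIV_neg_dec_left[OF d this] obtain \<delta> where \<delta>: "\<delta> > 0"
      "\<And>h. h > 0 \<Longrightarrow> h < \<delta> \<Longrightarrow> G t0 - (c + \<eta>) * t0 < G (t0 - h) - (c + \<eta>) * (t0 - h)" by blast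
    define h where "h = min (\<delta> / 2) t0"
    have h: "h > 0" "h < \<delta>" "h \<le> t0" using \<delta>(1) t0pos by (auto simp: h_def)
    have "\<gamma> < \<phi> (t0 - h)"
      using \<delta>(2)[OF h(1,2)] G(2) G(4)[of "t0 - h"] eq by (simp add: \<phi>_def)
    thus False using below[of "t0 - h"] h by simp
  qed
  thus "f 1 \<le> f 0 + c + \<eta>" by (simp add: \<phi>_def)
qed

section \<open>Convexity and rearrangement estimates\<close>

text \<open>
  Convexity of the arcsine on \<open>[0, 1]\<close>, with the missing weight placed at
  \<open>arcsin 0 = 0\<close>. The proof works on the side of the concave sine, through its
  tangent at the weighted mean \<open>\<psi>\<close> of the angles.
\<close>

lemma arcsin_le_weighted_sum:
  fixes w \<phi> :: "nat \<Rightarrow> real"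
  assumes w: "\<And>l. l < k \<Longrightarrow> 0 \<le> w l" "(\<Sum>l<k. w l) \<le> 1"
    and \<phi>: "\<And>l. l < k \<Longrightarrow> 0 \<le> \<phi> l" "\<And>l. l < k \<Longrightarrow> \<phi> l \<le> pi / 2"
    and x: "-1 \<le> x" "x \<le> (\<Sum>l<k. w l * sin (\<phi> l))"
  shows "arcsin x \<le> (\<Sum>l<k. w l * \<phi> l)"
proof -
  define \<psi> where "\<psi> = (\<Sum>l<k. w l * \<phi> l)"
  have \<psi>0: "0 \<le> \<psi>" unfolding \<psi>_def by (intro sum_nonneg mult_nonneg_nonneg) (auto simp: w \<phi>)
  have "\<psi> \<le> (\<Sum>l<k. w l * (pi / 2))" unfolding \<psi>_def
    by (intro sum_mono mult_left_mono) (use w \<phi> in auto)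
  also have "\<dots> = (\<Sum>l<k. w l) * (pi / 2)" by (simp add: sum_distrib_right)
  also have "\<dots> \<le> 1 * (pi / 2)" using w(2) by (intro mult_right_mono) auto
  finally have \<psi>1: "\<psi> \<le> pi / 2" by simp
  have tangent: "sin y \<le> sin \<psi> + cos \<psi> * (y - \<psi>)" if y: "0 \<le> y" "y \<le> pi / 2" for y
  proof -
    consider "y = \<psi>" | "y < \<psi>" | "\<psi> < y" by linarith
    thus ?thesis
    proof cases
      case 2
      obtain z where z: "z > y" "z < \<psi>" "sin \<psi> - sin y = (\<psi> - y) * cos z"
        using MVT2[OF 2, of sin cos] by (auto intro: DERIV_sin)
      have "cos \<psi> \<le> cos z" using z y \<psi>1 \<psi>0 by (intro cos_monotone_0_pi_le) auto
      hence "(\<psi> - y) * cos \<psi> \<le> (\<psi> - y) * cos z" using 2 by (intro mult_left_mono) auto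
      thus ?thesis using z(3) by (simp add: algebra_simps)
    next
      case 3
      obtain z where z: "z > \<psi>" "z < y" "sin y - sin \<psi> = (y - \<psi>) * cos z"
        using MVT2[OF 3, of sin cos] by (auto intro: DERIV_sin)
      have "cos z \<le> cos \<psi>" using z y \<psi>1 \<psi>0 by (intro cos_monotone_0_pi_le) auto
      hence "(y - \<psi>) * cos z \<le> (y - \<psi>) * cos \<psi>" using 3 by (intro mult_left_mono) auto
      thus ?thesis using z(3) by (simp add: algebra_simps)
    qed simp
  qed
  \<comment> \<open>the tangent is nonnegative at \<open>0\<close>, which makes total weight below \<open>1\<close> harmless\<close>
  have at0: "0 \<le> sin \<psi> - cos \<psi> * \<psi>" using tangent[of 0] by simp
  have "x \<le> (\<Sum>l<k. w l * sin (\<phi> l))" by (rule x)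
  also have "\<dots> \<le> (\<Sum>l<k. w l * (sin \<psi> + cos \<psi> * (\<phi> l - \<psi>)))"
    by (intro sum_mono mult_left_mono tangent) (use w \<phi> in auto)
  also have "\<dots> = (\<Sum>l<k. w l * (sin \<psi> - cos \<psi> * \<psi>) + cos \<psi> * (w l * \<phi> l))"
    by (simp add: algebra_simps)
  also have "\<dots> = (\<Sum>l<k. w l) * (sin \<psi> - cos \<psi> * \<psi>) + cos \<psi> * \<psi>"
    by (simp add: \<psi>_def sum.distrib sum_distrib_left sum_distrib_right)
  also have "\<dots> \<le> 1 * (sin \<psi> - cos \<psi> * \<psi>) + cos \<psi> * \<psi>"
    using w(2) at0 by (intro add_right_mono mult_right_mono) auto
  finally have le: "x \<le> sin \<psi>" by simp
  have "arcsin x \<le> arcsin (sin \<psi>)" using x(1) le by (intro arcsin_le_arcsin) auto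
  also have "\<dots> = \<psi>" using \<psi>0 \<psi>1 by (intro arcsin_sin) auto
  finally show ?thesis by (simp add: \<psi>_def)
qed

text \<open>
  The pivot \<open>p\<close> separates the first \<open>j\<close> values from the others: after
  subtracting \<open>p\<close>, weights at most \<open>1\<close> can only lower the nonnegative
  terms and nonnegative weights can only lower the nonpositive ones. The last hypothesis says
  that the total weight is \<open>j\<close>, or is below \<open>j\<close> and \<open>p\<close>
  is nonnegative (or symmetrically).
\<close>

lemma weighted_sum_le_top_sum:
  fixes x w :: "nat \<Rightarrow> real"
  assumes j: "j \<le> k" and w: "\<And>l. l < k \<Longrightarrow> 0 \<le> w l" "\<And>l. l < k \<Longrightarrow> w l \<le> 1"
    and upper: "\<And>l. l < j \<Longrightarrow> p \<le> x l" and lower: "\<And>l. j \<le> l \<Longrightarrow> l < k \<Longrightarrow> x l \<le> p"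
    and pivot: "((\<Sum>l<k. w l) - real j) * p \<le> 0"
  shows "(\<Sum>l<k. w l * x l) \<le> (\<Sum>l<j. x l)"
proof -
  have split: "(\<Sum>l<k. g l) = (\<Sum>l<j. g l) + (\<Sum>l=j..<k. g l)" for g :: "nat \<Rightarrow> real"
    using j by (simp add: sum.atLeastLessThan_concat[of 0 j k, symmetric] flip: atLeast0LessThan)
  have "(\<Sum>l<j. w l * (x l - p)) \<le> (\<Sum>l<j. 1 * (x l - p))"
    using w j upper by (intro sum_mono mult_right_mono) auto
  moreover have "(\<Sum>l=j..<k. w l * (x l - p)) \<le> 0"
    using w lower by (intro sum_nonpos mult_nonneg_nonpos) auto
  ultimately have "(\<Sum>l<k. w l * (x l - p)) \<le> (\<Sum>l<j. x l) - real j * p"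
    unfolding split by (simp add: sum_subtractf)
  moreover have "(\<Sum>l<k. w l * (x l - p)) = (\<Sum>l<k. w l * x l) - (\<Sum>l<k. w l) * p"
    by (simp add: algebra_simps sum_subtractf sum_distrib_left)
  ultimately show ?thesis using pivot by (simp add: algebra_simps)
qed

section \<open>Inner products of complex coordinate vectors\<close>

text \<open>
  Vectors are functions on the natural numbers of which only the first \<open>n\<close> values
  matter. This keeps sums of vectors free of dimension side conditions; the inner product is
  linear in the first argument.
\<close>

definition ip :: "nat \<Rightarrow> (nat \<Rightarrow> complex) \<Rightarrow> (nat \<Rightarrow> complex) \<Rightarrow> complex" where
  "ip n x y = (\<Sum>m<n. x m * cnj (y m))"

definition nsq :: "nat \<Rightarrow> (nat \<Rightarrow> complex) \<Rightarrow> real" where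
  "nsq n x = (\<Sum>m<n. (cmod (x m))\<^sup>2)"

definition comb :: "'a set \<Rightarrow> ('a \<Rightarrow> complex) \<Rightarrow> ('a \<Rightarrow> nat \<Rightarrow> complex) \<Rightarrow> nat \<Rightarrow> complex" where
  "comb I a e m = (\<Sum>i\<in>I. a i * e i m)"

lemma ip_cnj: "cnj (ip n x y) = ip n y x"
  by (simp add: ip_def mult.commute)

lemma norm_ip_commute: "cmod (ip n x y) = cmod (ip n y x)"
  by (metis complex_mod_cnj ip_cnj)

lemma ip_self: "ip n x x = of_real (nsq n x)"
  by (simp add: ip_def nsq_def complex_norm_square[symmetric] del: of_real_power)

lemma nsq_nonneg [simp]: "0 \<le> nsq n x" by (simp add: nsq_def sum_nonneg)

lemma ip_comb_left: "ip n (comb I a e) y = (\<Sum>i\<in>I. a i * ip n (e i) y)"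
  unfolding ip_def comb_def sum_distrib_left sum_distrib_right
  by (subst sum.swap) (simp add: mult.assoc)

lemma ip_comb_right: "ip n x (comb I a e) = (\<Sum>i\<in>I. cnj (a i) * ip n x (e i))"
  by (subst ip_cnj[symmetric], subst ip_comb_left) (simp add: ip_cnj)

lemma ip_diff_left: "ip n (\<lambda>m. x m - x' m) y = ip n x y - ip n x' y"
  by (simp add: ip_def algebra_simps sum_subtractf)

lemma ip_diff_right: "ip n x (\<lambda>m. y m - y' m) = ip n x y - ip n x y'"
  by (simp add: ip_def algebra_simps sum_subtractf)

lemma ip_add_left: "ip n (\<lambda>m. x m + x' m) y = ip n x y + ip n x' y"
  by (simp add: ip_def algebra_simps sum.distrib)

lemma ip_add_right: "ip n x (\<lambda>m. y m + y' m) = ip n x y + ip n x y'"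
  by (simp add: ip_def algebra_simps sum.distrib)

lemma ip_scale_left: "ip n (\<lambda>m. a * x m) y = a * ip n x y"
  by (simp add: ip_def sum_distrib_left mult.assoc)

lemma ip_scale_right: "ip n x (\<lambda>m. a * y m) = cnj a * ip n x y"
  by (simp add: ip_def sum_distrib_left algebra_simps)

lemma ip_cong: "(\<And>m. m < n \<Longrightarrow> x m = x' m) \<Longrightarrow> (\<And>m. m < n \<Longrightarrow> y m = y' m) \<Longrightarrow> ip n x y = ip n x' y'"
  by (simp add: ip_def)

definition delta :: "nat \<Rightarrow> nat \<Rightarrow> complex" where "delta m i = (if i = m then 1 else 0)"

lemma ip_delta_left: "m < n \<Longrightarrow> ip n (delta m) y = cnj (y m)"
  by (simp add: ip_def delta_def if_distrib[of "\<lambda>z. z * _"] cong: if_cong)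

lemma nsq_delta: "m < n \<Longrightarrow> nsq n (delta m) = 1"
  by (simp add: nsq_def delta_def if_distrib[of cmod] if_distrib[of "\<lambda>z. z^2"] cong: if_cong)

text \<open>
  Norms at most \<open>1\<close> are enough, so zero vectors may occur in the family: the normal
  part of a principal vector lying in the fixed subspace is zero. The proof expands the squared
  norm of \<open>v - \<Sum> \<langle>v, e\<^sub>i\<rangle> e\<^sub>i\<close>.
\<close>

lemma bessel:
  assumes "finite I" and orth: "\<And>i j. i \<in> I \<Longrightarrow> j \<in> I \<Longrightarrow> i \<noteq> j \<Longrightarrow> ip n (e i) (e j) = 0"
    and le: "\<And>i. i \<in> I \<Longrightarrow> nsq n (e i) \<le> 1"
  shows "(\<Sum>i\<in>I. (cmod (ip n v (e i)))\<^sup>2) \<le> nsq n v"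
proof -
  define a where "a i = ip n v (e i)" for i
  define w where "w m = v m - comb I a e m" for m
  have 1: "ip n (comb I a e) (comb I a e) = (\<Sum>i\<in>I. of_real ((cmod (a i))\<^sup>2 * nsq n (e i)))"
  proof -
    have "ip n (comb I a e) (comb I a e) = (\<Sum>i\<in>I. a i * (\<Sum>j\<in>I. cnj (a j) * ip n (e i) (e j)))"
      by (simp only: ip_comb_left) (simp only: ip_comb_right)
    also have "\<dots> = (\<Sum>i\<in>I. a i * (\<Sum>j\<in>I. if j = i then cnj (a i) * ip n (e i) (e i) else 0))"
      by (intro sum.cong refl arg_cong2[of _ _ _ _ "(*)"]) (auto simp: orth)
    also have "\<dots> = (\<Sum>i\<in>I. of_real ((cmod (a i))\<^sup>2 * nsq n (e i)))"
      using \<open>finite I\<close> by (simp add: ip_self complex_norm_square mult.assoc del: of_real_power)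
    finally show ?thesis .
  qed
  have 2: "ip n v (comb I a e) = of_real (\<Sum>i\<in>I. (cmod (a i))\<^sup>2)"
    by (simp add: ip_comb_right complex_norm_square a_def[symmetric] mult.commute del: of_real_power)
  have 3: "ip n (comb I a e) v = of_real (\<Sum>i\<in>I. (cmod (a i))\<^sup>2)"
    by (metis 2 complex_cnj_complex_of_real ip_cnj)
  have "complex_of_real (nsq n w) = of_real (nsq n v - 2 * (\<Sum>i\<in>I. (cmod (a i))\<^sup>2) +
      (\<Sum>i\<in>I. (cmod (a i))\<^sup>2 * nsq n (e i)))"
    unfolding ip_self[symmetric] w_def ip_diff_left ip_diff_right 1 2 3
    by (simp add: ip_self)
  hence "nsq n w = nsq n v - 2 * (\<Sum>i\<in>I. (cmod (a i))\<^sup>2) + (\<Sum>i\<in>I. (cmod (a i))\<^sup>2 * nsq n (e i))"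
    using of_real_eq_iff by blast
  moreover have "(\<Sum>i\<in>I. (cmod (a i))\<^sup>2 * nsq n (e i)) \<le> (\<Sum>i\<in>I. (cmod (a i))\<^sup>2 * 1)"
    by (intro sum_mono mult_left_mono le) auto
  moreover have "0 \<le> nsq n w" by simp
  ultimately show ?thesis by (simp add: a_def)
qed

lemma bessel_single: "nsq n y \<le> 1 \<Longrightarrow> (cmod (ip n x y))\<^sup>2 \<le> nsq n x"
  using bessel[of "{0::nat}" n "\<lambda>_. y" x] by simp

definition orthonormal :: "nat \<Rightarrow> 'a set \<Rightarrow> ('a \<Rightarrow> nat \<Rightarrow> complex) \<Rightarrow> bool" where
  "orthonormal n I e \<longleftrightarrow> (\<forall>i\<in>I. \<forall>j\<in>I. ip n (e i) (e j) = (if i = j then 1 else 0))"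

lemma orthonormal_ip:
  "orthonormal n I e \<Longrightarrow> i \<in> I \<Longrightarrow> j \<in> I \<Longrightarrow> ip n (e i) (e j) = (if i = j then 1 else 0)"
  by (simp add: orthonormal_def)

lemma orthonormal_nsq: "orthonormal n I e \<Longrightarrow> i \<in> I \<Longrightarrow> nsq n (e i) = 1"
  using ip_self[of n "e i"] by (simp add: orthonormal_def)

lemma bessel_orthonormal:
  "finite I \<Longrightarrow> orthonormal n I e \<Longrightarrow> (\<Sum>i\<in>I. (cmod (ip n v (e i)))\<^sup>2) \<le> nsq n v"
  by (rule bessel) (auto simp: orthonormal_nsq orthonormal_def)

text \<open>
  The squared moduli of the entries form a doubly substochastic array. This is what feeds the
  rearrangement estimate in the Ky Fan principle.
\<close>

lemma orthonormal_weights: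
  assumes "finite I" "orthonormal n I e"
  shows "m < n \<Longrightarrow> (\<Sum>i\<in>I. (cmod (e i m))\<^sup>2) \<le> 1"
    and "(\<Sum>m<n. \<Sum>i\<in>I. (cmod (e i m))\<^sup>2) = real (card I)"
    and "card I \<le> n"
proof -
  show 1: "(\<Sum>i\<in>I. (cmod (e i m))\<^sup>2) \<le> 1" if "m < n" for m
    using bessel_orthonormal[OF assms, of "delta m"] that by (simp add: ip_delta_left nsq_delta)
  show 2: "(\<Sum>m<n. \<Sum>i\<in>I. (cmod (e i m))\<^sup>2) = real (card I)"
    using assms by (subst sum.swap) (simp flip: nsq_def add: orthonormal_nsq)
  have "real (card I) \<le> (\<Sum>m<n. 1)" unfolding 2[symmetric] by (intro sum_mono) (auto simp: 1)
  thus "card I \<le> n" by simp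
qed

section \<open>The Ky Fan principle and the spectral spread\<close>

lemma ky_fan_upper:
  assumes "finite I" "orthonormal n I g" and lam: "\<And>a b. a \<le> b \<Longrightarrow> b < n \<Longrightarrow> lam b \<le> lam a"
  shows "(\<Sum>i\<in>I. \<Sum>m<n. lam m * (cmod (g i m))\<^sup>2) \<le> (\<Sum>m<card I. lam m)"
proof -
  note w = orthonormal_weights[OF assms(1,2)]
  have "(\<Sum>i\<in>I. \<Sum>m<n. lam m * (cmod (g i m))\<^sup>2) = (\<Sum>m<n. (\<Sum>i\<in>I. (cmod (g i m))\<^sup>2) * lam m)"
    by (subst sum.swap) (simp add: sum_distrib_right sum_distrib_left mult.commute)
  also have "\<dots> \<le> (\<Sum>m<card I. lam m)"
    \<comment> \<open>the total weight is exactly \<open>card I\<close>, so any separating value may serve as pivot, also when \<open>card I = n\<close>\<close>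
    by (rule weighted_sum_le_top_sum[where p = "lam (min (card I) (n - 1))"])
       (use w in \<open>auto intro!: sum_nonneg lam\<close>)
  finally show ?thesis .
qed

lemma ky_fan_lower:
  assumes "finite I" "orthonormal n I g" and lam: "\<And>a b. a \<le> b \<Longrightarrow> b < n \<Longrightarrow> lam b \<le> lam a"
  shows "(\<Sum>m<card I. lam (n - 1 - m)) \<le> (\<Sum>i\<in>I. \<Sum>m<n. lam m * (cmod (g i m))\<^sup>2)"
proof -
  define g' where "g' i m = g i (n - 1 - m)" for i m
  have flip: "(\<Sum>m<n. h (n - 1 - m)) = (\<Sum>m<n. h m)" for h :: "nat \<Rightarrow> 'b::comm_monoid_add"
    using sum.nat_diff_reindex[of h n] by simp
  have "orthonormal n I g'" using assms(2) unfolding orthonormal_def g'_def ip_def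
    by (subst flip[of "\<lambda>m. g _ m * cnj (g _ m)"])
  hence "(\<Sum>i\<in>I. \<Sum>m<n. - lam (n - 1 - m) * (cmod (g' i m))\<^sup>2) \<le> (\<Sum>m<card I. - lam (n - 1 - m))"
    by (intro ky_fan_upper[OF assms(1)]) (auto intro!: lam)
  moreover have "(\<Sum>m<n. - lam (n - 1 - m) * (cmod (g' i m))\<^sup>2) = (\<Sum>m<n. - lam m * (cmod (g i m))\<^sup>2)" for i
    unfolding g'_def by (rule flip)
  ultimately show ?thesis by (simp add: sum_negf)
qed

text \<open>
  Sum of the first \<open>j\<close> entries of half the spectral spread, in terms of the
  non-increasing eigenvalues \<open>lam\<close>.
\<close>

definition half_spread_sum :: "nat \<Rightarrow> (nat \<Rightarrow> real) \<Rightarrow> nat \<Rightarrow> real" where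
  "half_spread_sum n lam j = (\<Sum>i<min j (n div 2). (lam i - lam (n - 1 - i)) / 2)"

text \<open>
  Pairing \<open>lam i\<close> with \<open>lam (n - 1 - i)\<close> beyond the middle of the
  spectrum contributes nonpositive terms, and up to the middle nonnegative ones.
\<close>

lemma half_spread_sum_ge:
  assumes lam: "\<And>a b. a \<le> b \<Longrightarrow> b < n \<Longrightarrow> lam b \<le> lam a" and r: "r \<le> j" "r \<le> n"
  shows "(\<Sum>i<r. (lam i - lam (n - 1 - i)) / 2) \<le> half_spread_sum n lam j"
proof -
  define h where "h i = (lam i - lam (n - 1 - i)) / 2" for i
  define q where "q = min r (n div 2)"
  have "(\<Sum>i<r. h i) = (\<Sum>i<q. h i) + (\<Sum>i=q..<r. h i)"
    by (simp add: q_def sum.atLeastLessThan_concat[of 0 _ r, symmetric] flip: atLeast0LessThan)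
  moreover have "(\<Sum>i=q..<r. h i) \<le> 0"
  proof (rule sum_nonpos)
    fix i assume i: "i \<in> {q..<r}"
    hence "n div 2 \<le> i" "i < n" using r by (auto simp: q_def min_def split: if_splits)
    hence "lam i \<le> lam (n - 1 - i)" by (intro lam) auto
    thus "h i \<le> 0" by (simp add: h_def)
  qed
  moreover have "(\<Sum>i<q. h i) \<le> (\<Sum>i<min j (n div 2). h i)"
  proof (rule sum_mono2)
    fix i assume "i \<in> {..<min j (n div 2)} - {..<q}"
    hence "lam (n - 1 - i) \<le> lam i" by (intro lam) auto
    thus "0 \<le> h i" by (simp add: h_def)
  qed (use r in \<open>auto simp: q_def\<close>)
  ultimately show ?thesis by (simp add: half_spread_sum_def h_def)
qed

lemma Im_ip_weighted:
  "Im (ip n (\<lambda>m. of_real (w m) * x m) y) = (\<Sum>m<n. w m * Im (x m * cnj (y m)))"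
proof -
  have "Im (of_real a * z) = a * Im z" for a z by simp
  thus ?thesis by (simp only: ip_def Im_sum mult.assoc)
qed

text \<open>
  Polarization: with \<open>g\<^sub>\<plusminus> = (p \<plusminus> \<i> c)/\<surd>2\<close> one
  has \<open>- 2 Im \<langle>X p, c\<rangle> = \<langle>X g\<^sub>-, g\<^sub>-\<rangle> -
  \<langle>X g\<^sub>+, g\<^sub>+\<rangle>\<close>. Both families \<open>g\<^sub>-\<close> and
  \<open>g\<^sub>+\<close> are orthonormal, so the Ky Fan principle bounds the first sum above
  by the largest and the second below by the smallest eigenvalues.
\<close>

lemma paired_form_le:
  assumes "finite J" and pp: "orthonormal n J p" and cc: "orthonormal n J c"
    and pc: "\<And>i j. i \<in> J \<Longrightarrow> j \<in> J \<Longrightarrow> ip n (p i) (c j) = 0"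
    and lam: "\<And>a b. a \<le> b \<Longrightarrow> b < n \<Longrightarrow> lam b \<le> lam a"
    and j: "card J \<le> j"
  shows "(\<Sum>i\<in>J. - Im (ip n (\<lambda>m. of_real (lam m) * p i m) (c i))) \<le> half_spread_sum n lam j"
proof -
  define s :: complex where "s = of_real (1 / sqrt 2)"
  have s: "s * cnj s = 1 / 2" by (simp add: s_def flip: of_real_mult)
  have cp: "ip n (c i) (p j) = 0" if "i \<in> J" "j \<in> J" for i j
    using pc[OF that(2,1)] by (metis complex_cnj_zero ip_cnj)
  define g where "g z i m = s * (p i m + z * c i m)" for z :: complex and i m
  have g: "orthonormal n J (g z)" if "z * cnj z = 1" for z
    unfolding orthonormal_def
  proof (intro ballI)
    fix i j assume ij: "i \<in> J" "j \<in> J"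
    have "ip n (g z i) (g z j) = s * cnj s * (ip n (p i) (p j) + z * cnj z * ip n (c i) (c j))"
      unfolding g_def ip_scale_left ip_scale_right ip_add_left ip_add_right
      using ij by (simp add: pc cp algebra_simps)
    also have "\<dots> = (if i = j then 1 else 0)" unfolding s that
      using ij by (simp add: orthonormal_ip[OF pp] orthonormal_ip[OF cc])
    finally show "ip n (g z i) (g z j) = (if i = j then 1 else 0)" .
  qed
  have o1: "orthonormal n J (g (- \<i>))" and o2: "orthonormal n J (g \<i>)" by (auto intro!: g)
  have key: "(cmod (g (- \<i>) i m))\<^sup>2 - (cmod (g \<i> i m))\<^sup>2 = - 2 * Im (p i m * cnj (c i m))" for i m
  proof -
    have s2: "(cmod s)\<^sup>2 = 1 / 2" by (simp add: s_def norm_divide power_divide)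
    have "(cmod (g (- \<i>) i m))\<^sup>2 - (cmod (g \<i> i m))\<^sup>2 =
       ((cmod (p i m - \<i> * c i m))\<^sup>2 - (cmod (p i m + \<i> * c i m))\<^sup>2) / 2"
      by (simp only: g_def norm_mult power_mult_distrib s2) (simp add: diff_divide_distrib)
    also have "\<dots> = - 2 * Im (p i m * cnj (c i m))"
      unfolding cmod_power2 by (simp add: power2_eq_square field_simps)
    finally show ?thesis .
  qed
  have "2 * (\<Sum>i\<in>J. - Im (ip n (\<lambda>m. of_real (lam m) * p i m) (c i)))
     = (\<Sum>i\<in>J. \<Sum>m<n. lam m * (- 2 * Im (p i m * cnj (c i m))))"
    unfolding Im_ip_weighted sum_distrib_left sum_negf[symmetric]
    by (intro sum.cong refl) (simp only: mult_minus_left mult_minus_right mult.left_commute)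
  also have "\<dots> = (\<Sum>i\<in>J. \<Sum>m<n. lam m * (cmod (g (- \<i>) i m))\<^sup>2) - (\<Sum>i\<in>J. \<Sum>m<n. lam m * (cmod (g \<i> i m))\<^sup>2)"
    unfolding key[symmetric] by (simp add: sum_subtractf right_diff_distrib)
  also have "\<dots> \<le> (\<Sum>m<card J. lam m) - (\<Sum>m<card J. lam (n - 1 - m))"
    by (intro diff_mono ky_fan_upper ky_fan_lower lam o1 o2 assms(1))
  also have "\<dots> = 2 * (\<Sum>i<card J. (lam i - lam (n - 1 - i)) / 2)"
    by (simp add: sum_subtractf flip: sum_divide_distrib)
  also have "\<dots> \<le> 2 * half_spread_sum n lam j"
    using half_spread_sum_ge[OF lam j orthonormal_weights(3)[OF assms(1) pp]] by simp
  finally show ?thesis by simp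
qed

section \<open>Principal vectors of a rotating subspace\<close>

text \<open>
  The fixed subspace \<open>S\<close> is the span of the orthonormal vectors \<open>e i\<close>
  with \<open>i < k\<close>, in coordinates where the Hermitian generator is the diagonal matrix
  with entries \<open>lam\<close>.
\<close>

locale rotating_subspace =
  fixes n k :: nat and lam :: "nat \<Rightarrow> real" and e :: "nat \<Rightarrow> nat \<Rightarrow> complex"
  assumes basis: "orthonormal n {..<k} e"
    and lam_antimono: "\<And>a b. a \<le> b \<Longrightarrow> b < n \<Longrightarrow> lam b \<le> lam a"
begin

text \<open>
  The unitary group generated by the diagonal matrix.
\<close>

definition evolve :: "real \<Rightarrow> (nat \<Rightarrow> complex) \<Rightarrow> nat \<Rightarrow> complex" where
  "evolve t v m = cis (t * lam m) * v m"

definition proj :: "(nat \<Rightarrow> complex) \<Rightarrow> nat \<Rightarrow> complex" where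
  "proj v = comb {..<k} (\<lambda>i. ip n v (e i)) e"

text \<open>
  The \<open>a l\<close> form an orthonormal basis of \<open>S\<close> whose images at time
  \<open>t\<close> are principal vectors with respect to \<open>S\<close>: their projections to
  \<open>S\<close> are orthogonal, with lengths the cosines of the angles \<open>\<theta>
  l\<close>.
\<close>

definition principal :: "real \<Rightarrow> (nat \<Rightarrow> real) \<Rightarrow> (nat \<Rightarrow> nat \<Rightarrow> complex) \<Rightarrow> bool" where
  "principal t \<theta> a \<longleftrightarrow> orthonormal n {..<k} a
     \<and> (\<forall>v. proj v = comb {..<k} (\<lambda>l. ip n v (a l)) a)
     \<and> (\<forall>i<k. \<forall>j<k. ip n (proj (evolve t (a i))) (proj (evolve t (a j))) = (if i = j then of_real ((cos (\<theta> i))\<^sup>2) else 0))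
     \<and> (\<forall>i<k. 0 \<le> \<theta> i \<and> \<theta> i \<le> pi / 2) \<and> (\<forall>i j. i \<le> j \<longrightarrow> j < k \<longrightarrow> \<theta> j \<le> \<theta> i)"

text \<open>
  The compression to \<open>S\<close> of the unitary at time \<open>t\<close> has a kernel.
\<close>

definition singular_time :: "real \<Rightarrow> bool" where
  "singular_time t \<longleftrightarrow> (\<exists>x. (\<exists>l<k. x l \<noteq> 0) \<and> (\<forall>i<k. (\<Sum>l<k. x l * ip n (evolve t (e l)) (e i)) = 0))"

lemma ip_evolve [simp]: "ip n (evolve t x) (evolve t y) = ip n x y"
proof -
  have "cis a * x * cnj (cis a * y) = x * cnj y" for a x y
    using cis_mult[of a "- a"] by (simp add: cis_cnj algebra_simps)
  thus ?thesis by (simp only: ip_def evolve_def)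
qed

lemma evolve_comb: "evolve t (comb I a b) = comb I a (\<lambda>i. evolve t (b i))"
  by (simp add: fun_eq_iff evolve_def comb_def sum_distrib_left mult.left_commute)

lemma ip_proj_left: "ip n (proj x) y = (\<Sum>i<k. ip n x (e i) * ip n (e i) y)"
  by (simp add: proj_def ip_comb_left)

lemma ip_proj_right: "ip n x (proj y) = ip n (proj x) y"
proof -
  have "ip n x (proj y) = (\<Sum>i<k. cnj (ip n y (e i)) * ip n x (e i))"
    by (simp add: proj_def ip_comb_right)
  thus ?thesis by (simp add: ip_proj_left ip_cnj mult.commute)
qed

lemma ip_proj_basis: "i < k \<Longrightarrow> ip n (proj x) (e i) = ip n x (e i)"
  by (simp add: ip_proj_left orthonormal_ip[OF basis] if_distrib[of "\<lambda>z. _ * z"] cong: if_cong)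

lemma proj_proj [simp]: "proj (proj x) = proj x"
proof -
  have "proj (proj x) = comb {..<k} (\<lambda>i. ip n (proj x) (e i)) e" by (rule proj_def)
  also have "\<dots> = comb {..<k} (\<lambda>i. ip n x (e i)) e" by (simp add: comb_def fun_eq_iff ip_proj_basis)
  finally show ?thesis by (simp only: proj_def[of x])
qed

lemma principalD:
  assumes "principal t \<theta> a"
  shows "orthonormal n {..<k} a" "proj v = comb {..<k} (\<lambda>l. ip n v (a l)) a"
    "i < k \<Longrightarrow> 0 \<le> \<theta> i" "i < k \<Longrightarrow> \<theta> i \<le> pi / 2"
    "i \<le> j \<Longrightarrow> j < k \<Longrightarrow> \<theta> j \<le> \<theta> i"
    "i < k \<Longrightarrow> j < k \<Longrightarrow> ip n (proj (evolve t (a i))) (proj (evolve t (a j))) = (if i = j then of_real ((cos (\<theta> i))\<^sup>2) else 0)"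
  using assms by (auto simp: principal_def)

lemma principal_in_subspace:
  assumes "principal t \<theta> a" "l < k" shows "proj (a l) = a l"
  unfolding principalD(2)[OF assms(1)] comb_def
  using assms(2) by (simp add: fun_eq_iff orthonormal_ip[OF principalD(1)[OF assms(1)]]
      if_distrib[of "\<lambda>z. z * _"] cong: if_cong)

text \<open>
  Normalized component orthogonal to \<open>S\<close> of the \<open>i\<close>-th principal
  vector at time \<open>t\<close>. If the angle is \<open>0\<close>, division by zero makes it
  the zero vector; this convention lets all indices be treated alike.
\<close>

definition normal_part :: "real \<Rightarrow> (nat \<Rightarrow> real) \<Rightarrow> (nat \<Rightarrow> nat \<Rightarrow> complex) \<Rightarrow> nat \<Rightarrow> nat \<Rightarrow> complex" where
  "normal_part t \<theta> a i m = (evolve t (a i) m - proj (evolve t (a i)) m) / of_real (sin (\<theta> i))"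

lemma proj_normal_part: "ip n (proj v) (normal_part t \<theta> a i) = 0"
proof -
  have "normal_part t \<theta> a i = (\<lambda>m. inverse (of_real (sin (\<theta> i))) * (evolve t (a i) m - proj (evolve t (a i)) m))"
    by (simp add: normal_part_def fun_eq_iff divide_simps)
  thus ?thesis
    by (simp only: ip_scale_right ip_diff_right ip_proj_right proj_proj) simp
qed

lemma residual_ip:
  assumes pr: "principal t \<theta> a" and i: "i < k" and j: "j < k"
  shows "ip n (\<lambda>m. evolve t (a i) m - proj (evolve t (a i)) m) (\<lambda>m. evolve t (a j) m - proj (evolve t (a j)) m)
    = (if i = j then of_real ((sin (\<theta> i))\<^sup>2) else 0)"
proof -
  have eq: "ip n (proj x) y = ip n (proj x) (proj y)" "ip n x (proj y) = ip n (proj x) (proj y)" for x y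
    by (simp_all add: ip_proj_right)
  have "ip n (\<lambda>m. x m - proj x m) (\<lambda>m. y m - proj y m) = ip n x y - ip n (proj x) (proj y)" for x y
    using eq[of x y] by (simp add: ip_diff_left ip_diff_right)
  thus ?thesis
    using i j by (simp add: principalD(6)[OF pr] orthonormal_ip[OF principalD(1)[OF pr]] sin_squared_eq)
qed

lemma normal_part_ip:
  assumes pr: "principal t \<theta> a" and i: "i < k" and j: "j < k"
  shows "ip n (normal_part t \<theta> a i) (normal_part t \<theta> a j) = (if i = j \<and> sin (\<theta> i) \<noteq> 0 then 1 else 0)"
proof -
  have "normal_part t \<theta> a i = (\<lambda>m. inverse (of_real (sin (\<theta> i))) * (evolve t (a i) m - proj (evolve t (a i)) m))" for i
    by (simp add: normal_part_def fun_eq_iff divide_simps)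
  hence "ip n (normal_part t \<theta> a i) (normal_part t \<theta> a j) =
     inverse (of_real (sin (\<theta> i))) * (inverse (of_real (sin (\<theta> j))) *
       ip n (\<lambda>m. evolve t (a i) m - proj (evolve t (a i)) m) (\<lambda>m. evolve t (a j) m - proj (evolve t (a j)) m))"
    by (simp only: ip_scale_left ip_scale_right) simp
  also have "\<dots> = (if i = j \<and> sin (\<theta> i) \<noteq> 0 then 1 else 0)"
    unfolding residual_ip[OF assms] by (auto simp: power2_eq_square field_simps)
  finally show ?thesis .
qed

lemma normal_part_nsq_le: "principal t \<theta> a \<Longrightarrow> i < k \<Longrightarrow> nsq n (normal_part t \<theta> a i) \<le> 1"
  using normal_part_ip[of t \<theta> a i i] ip_self[of n "normal_part t \<theta> a i"] by (auto split: if_splits)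

lemma residual_eq_normal_part:
  assumes pr: "principal t \<theta> a" and i: "i < k" and m: "m < n"
  shows "evolve t (a i) m = proj (evolve t (a i)) m + of_real (sin (\<theta> i)) * normal_part t \<theta> a i m"
proof (cases "sin (\<theta> i) = 0")
  case True
  have "nsq n (\<lambda>m. evolve t (a i) m - proj (evolve t (a i)) m) = 0"
    using residual_ip[OF pr i i] True by (simp add: ip_self)
  hence "evolve t (a i) m - proj (evolve t (a i)) m = 0"
    using m by (simp add: nsq_def sum_nonneg_eq_0_iff)
  thus ?thesis using True by simp
qed (simp add: normal_part_def)

lemma ip_evolve_orthogonal:
  assumes pr: "principal t \<theta> a" and i: "i < k" and c: "\<And>v. ip n (proj v) c = 0"
  shows "ip n (evolve t (a i)) c = of_real (sin (\<theta> i)) * ip n (normal_part t \<theta> a i) c"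
proof -
  have "ip n (evolve t (a i)) c = ip n (\<lambda>m. proj (evolve t (a i)) m + of_real (sin (\<theta> i)) * normal_part t \<theta> a i m) c"
    by (intro ip_cong residual_eq_normal_part[OF pr i] refl)
  thus ?thesis by (simp add: ip_add_left ip_scale_left c)
qed

text \<open>
  Expand \<open>y i\<close> in the principal basis at time \<open>s\<close>. The inner product
  with \<open>c i\<close> becomes \<open>\<Sum>\<^sub>l sin (\<phi> l) \<langle>y\<^sub>i,
  d\<^sub>l\<rangle> \<langle>c'\<^sub>l, c\<^sub>i\<rangle>\<close>, whose real part is at most
  \<open>\<Sum>\<^sub>l W\<^sub>i\<^sub>l sin (\<phi> l)\<close> with
  \<open>W\<^sub>i\<^sub>l\<close> the mean of the two squared moduli. By Bessel's inequality
  all row and column sums of \<open>W\<close> are at most \<open>1\<close>. Convexity of the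
  arcsine handles each row, and rearrangement the sum over all rows.
\<close>

lemma sum_arcsin_le:
  assumes pr: "principal s \<phi> d" and r: "r \<le> k"
    and y: "\<And>i. i < r \<Longrightarrow> proj (y i) = y i" "orthonormal n {..<r} y"
    and c: "\<And>i v. i < r \<Longrightarrow> ip n (proj v) (c i) = 0"
      "\<And>i j. i < r \<Longrightarrow> j < r \<Longrightarrow> i \<noteq> j \<Longrightarrow> ip n (c i) (c j) = 0"
      "\<And>i. i < r \<Longrightarrow> nsq n (c i) \<le> 1"
  shows "(\<Sum>i<r. arcsin (Re (ip n (evolve s (y i)) (c i)))) \<le> (\<Sum>l<r. \<phi> l)"
proof -
  define c' where "c' = normal_part s \<phi> d"
  note pd = principalD[OF pr]
  define W where "W i l = ((cmod (ip n (y i) (d l)))\<^sup>2 + (cmod (ip n (c' l) (c i)))\<^sup>2) / 2" for i l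
  have yn: "nsq n (y i) = 1" if "i < r" for i using orthonormal_nsq[OF y(2)] that by simp
  have dn: "nsq n (d l) = 1" if "l < k" for l using orthonormal_nsq[OF pd(1)] that by simp
  have c'n: "nsq n (c' l) \<le> 1" if "l < k" for l using normal_part_nsq_le[OF pr that] by (simp add: c'_def)
  have row: "(\<Sum>l<k. W i l) \<le> 1" if i: "i < r" for i
  proof -
    have 1: "(\<Sum>l<k. (cmod (ip n (y i) (d l)))\<^sup>2) \<le> 1"
      using bessel_orthonormal[OF _ pd(1), of "y i"] yn[OF i] by simp
    have "(\<Sum>l<k. (cmod (ip n (c i) (c' l)))\<^sup>2) \<le> nsq n (c i)"
      by (rule bessel) (auto simp: c'_def normal_part_ip[OF pr] intro: normal_part_nsq_le[OF pr])
    hence 2: "(\<Sum>l<k. (cmod (ip n (c' l) (c i)))\<^sup>2) \<le> 1"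
      using c(3)[OF i] by (simp add: norm_ip_commute)
    show ?thesis using 1 2 by (simp add: W_def sum.distrib add_divide_distrib flip: sum_divide_distrib)
  qed
  have col: "(\<Sum>i<r. W i l) \<le> 1" if l: "l < k" for l
  proof -
    have "(\<Sum>i<r. (cmod (ip n (d l) (y i)))\<^sup>2) \<le> 1"
      using bessel_orthonormal[OF _ y(2), of "d l"] dn[OF l] by simp
    hence 1: "(\<Sum>i<r. (cmod (ip n (y i) (d l)))\<^sup>2) \<le> 1" by (simp add: norm_ip_commute)
    have "(\<Sum>i<r. (cmod (ip n (c' l) (c i)))\<^sup>2) \<le> nsq n (c' l)"
      by (rule bessel) (use c in auto)
    hence 2: "(\<Sum>i<r. (cmod (ip n (c' l) (c i)))\<^sup>2) \<le> 1" using c'n[OF l] by simp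
    show ?thesis using 1 2 by (simp add: W_def sum.distrib add_divide_distrib flip: sum_divide_distrib)
  qed
  have W0: "0 \<le> W i l" for i l by (simp add: W_def)
  have each: "arcsin (Re (ip n (evolve s (y i)) (c i))) \<le> (\<Sum>l<k. W i l * \<phi> l)" if i: "i < r" for i
  proof (rule arcsin_le_weighted_sum)
    have "(cmod (ip n (evolve s (y i)) (c i)))\<^sup>2 \<le> nsq n (evolve s (y i))"
      by (rule bessel_single) (rule c(3)[OF i])
    also have "\<dots> = 1" using ip_self[of n "evolve s (y i)"] ip_self[of n "y i"] yn[OF i] by simp
    finally have "cmod (ip n (evolve s (y i)) (c i)) \<le> 1" by (simp add: abs_square_le_1)
    thus "-1 \<le> Re (ip n (evolve s (y i)) (c i))"
      using abs_Re_le_cmod[of "ip n (evolve s (y i)) (c i)"] by linarith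
    have "y i = comb {..<k} (\<lambda>l. ip n (y i) (d l)) d" using pd(2)[of "y i"] y(1)[OF i] by simp
    from arg_cong[OF this, of "\<lambda>v. ip n (evolve s v) (c i)"]
    have "ip n (evolve s (y i)) (c i) = (\<Sum>l<k. ip n (y i) (d l) * ip n (evolve s (d l)) (c i))"
      by (simp only: evolve_comb ip_comb_left)
    also have "\<dots> = (\<Sum>l<k. ip n (y i) (d l) * (of_real (sin (\<phi> l)) * ip n (c' l) (c i)))"
      by (intro sum.cong refl arg_cong2[of _ _ _ _ "(*)"])
         (simp add: ip_evolve_orthogonal[OF pr _ c(1)[OF i]] c'_def)
    finally have "cmod (ip n (evolve s (y i)) (c i)) \<le>
       (\<Sum>l<k. cmod (ip n (y i) (d l) * (of_real (sin (\<phi> l)) * ip n (c' l) (c i))))"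
      by (simp add: norm_sum)
    also have "\<dots> \<le> (\<Sum>l<k. W i l * sin (\<phi> l))"
    proof (rule sum_mono)
      fix l assume "l \<in> {..<k}"
      hence sin0: "0 \<le> sin (\<phi> l)" using pd(3)[of l] pd(4)[of l] by (intro sin_ge_zero) auto
      have "cmod (ip n (y i) (d l)) * cmod (ip n (c' l) (c i)) \<le> W i l"
        using sum_squares_bound[of "cmod (ip n (y i) (d l))" "cmod (ip n (c' l) (c i))"]
        by (simp add: W_def)
      from mult_right_mono[OF this sin0] sin0
      show "cmod (ip n (y i) (d l) * (of_real (sin (\<phi> l)) * ip n (c' l) (c i))) \<le> W i l * sin (\<phi> l)"
        by (simp add: norm_mult mult_ac)
    qed
    finally show "Re (ip n (evolve s (y i)) (c i)) \<le> (\<Sum>l<k. W i l * sin (\<phi> l))"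
      using complex_Re_le_cmod order_trans by blast
  qed (use W0 row[OF i] pd(3,4) in auto)
  have "(\<Sum>i<r. arcsin (Re (ip n (evolve s (y i)) (c i)))) \<le> (\<Sum>i<r. \<Sum>l<k. W i l * \<phi> l)"
    by (intro sum_mono each) simp
  also have "\<dots> = (\<Sum>l<k. (\<Sum>i<r. W i l) * \<phi> l)"
    by (subst sum.swap) (simp add: sum_distrib_right)
  also have "\<dots> \<le> (\<Sum>l<r. \<phi> l)"
  proof (rule weighted_sum_le_top_sum[where p = "if r < k then \<phi> r else 0"])
    have "(\<Sum>l<k. \<Sum>i<r. W i l) = (\<Sum>i<r. \<Sum>l<k. W i l)" by (rule sum.swap)
    also have "\<dots> \<le> (\<Sum>i<r. 1)" by (intro sum_mono row) simp
    finally have "(\<Sum>l<k. \<Sum>i<r. W i l) - real r \<le> 0" by simp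
    moreover have "0 \<le> (if r < k then \<phi> r else 0)" using pd(3) by simp
    ultimately show "((\<Sum>l<k. \<Sum>i<r. W i l) - real r) * (if r < k then \<phi> r else 0) \<le> 0"
      by (simp only: mult_nonpos_nonneg)
  qed (use r W0 col pd(3,5) in \<open>auto intro: sum_nonneg\<close>)
  finally show ?thesis .
qed

end

section \<open>Growth of the sum of the largest angles\<close>

lemma arcsin_uniformly_continuous:
  assumes "\<epsilon> > 0"
  obtains \<delta> where "\<delta> > 0"
    "\<And>x y. -1 \<le> x \<Longrightarrow> x \<le> 1 \<Longrightarrow> -1 \<le> y \<Longrightarrow> y \<le> 1 \<Longrightarrow> \<bar>x - y\<bar> < \<delta> \<Longrightarrow> \<bar>arcsin x - arcsin y\<bar> < \<epsilon>"
proof -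
  have "uniformly_continuous_on {-1..1} arcsin"
    by (intro compact_uniformly_continuous continuous_on_arcsin') auto
  then obtain \<delta> where "\<delta> > 0" "\<And>x y. x \<in> {-1..1} \<Longrightarrow> y \<in> {-1..1} \<Longrightarrow> dist y x < \<delta> \<Longrightarrow> dist (arcsin y) (arcsin x) < \<epsilon>"
    using assms unfolding uniformly_continuous_on_def by meson
  thus ?thesis by (intro that[of \<delta>]) (auto simp: dist_real_def)
qed

lemma norm_cis_diff_le: "cmod (cis a - cis b) \<le> \<bar>a - b\<bar>"
proof -
  have "(cmod (cis a - cis b))\<^sup>2 = 2 - 2 * cos (a - b)"
    using sin_cos_squared_add[of a] sin_cos_squared_add[of b]
    unfolding cmod_power2 cos_diff by (simp only: minus_complex.sel cis.sel power2_diff ring_distribs mult.assoc)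
  also have "\<dots> = 4 * (sin ((a - b) / 2))\<^sup>2"
    using cos_double_sin[of "(a - b) / 2"] by (simp only: mult_2 field_sum_of_halves)
  also have "\<dots> \<le> 4 * ((a - b) / 2)\<^sup>2"
    by (rule mult_left_mono[OF abs_sin_x_le_abs_x[of "(a - b) / 2", unfolded abs_le_square_iff]]) simp
  also have "\<dots> = \<bar>a - b\<bar>\<^sup>2" by (simp add: power2_eq_square)
  finally show ?thesis by (rule power2_le_imp_le) simp
qed

context rotating_subspace
begin

lemma ip_evolve_normal_part:
  assumes "principal t \<theta> a" "i < k"
  shows "ip n (evolve t (a i)) (normal_part t \<theta> a i) = of_real (sin (\<theta> i))"
  by (auto simp: ip_evolve_orthogonal[OF assms proj_normal_part] normal_part_ip[OF assms(1,2,2)])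

lemma arcsin_sin_angle: "principal t \<theta> a \<Longrightarrow> i < k \<Longrightarrow> arcsin (sin (\<theta> i)) = \<theta> i"
  using principalD(3,4)[of t \<theta> a i] by (intro arcsin_sin) auto

lemma sum_arcsin_normal_part_le:
  assumes pt: "principal t \<theta> a" and ps: "principal s \<phi> d" and r: "r \<le> k"
  shows "(\<Sum>i<r. arcsin (Re (ip n (evolve s (a i)) (normal_part t \<theta> a i)))) \<le> (\<Sum>l<r. \<phi> l)"
  using r principalD(1)[OF pt]
  by (intro sum_arcsin_le[OF ps r])
     (auto simp: principal_in_subspace[OF pt] proj_normal_part normal_part_ip[OF pt] orthonormal_def
       intro: normal_part_nsq_le[OF pt])

text \<open>
  In eigencoordinates the unitary group is Lipschitz in time, with constant the sum of the
  moduli of the eigenvalues.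
\<close>

lemma nsq_evolve_diff_le:
  "nsq n (\<lambda>m. evolve s v m - evolve t v m) \<le> ((\<Sum>m<n. \<bar>lam m\<bar>) * \<bar>s - t\<bar>)\<^sup>2 * nsq n v"
proof -
  define L where "L = (\<Sum>m<n. \<bar>lam m\<bar>)"
  have "(cmod (evolve s v m - evolve t v m))\<^sup>2 \<le> (L * \<bar>s - t\<bar>)\<^sup>2 * (cmod (v m))\<^sup>2" if "m < n" for m
  proof -
    have "\<bar>lam m\<bar> \<le> L" unfolding L_def using that by (intro member_le_sum) auto
    hence "\<bar>s * lam m - t * lam m\<bar> \<le> L * \<bar>s - t\<bar>"
      by (metis abs_ge_zero abs_mult left_diff_distrib mult.commute mult_right_mono)
    hence "cmod (cis (s * lam m) - cis (t * lam m)) \<le> L * \<bar>s - t\<bar>"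
      using norm_cis_diff_le order_trans by blast
    hence "(cmod (cis (s * lam m) - cis (t * lam m)))\<^sup>2 \<le> (L * \<bar>s - t\<bar>)\<^sup>2"
      by (intro power_mono) auto
    moreover have "evolve s v m - evolve t v m = (cis (s * lam m) - cis (t * lam m)) * v m"
      by (simp add: evolve_def algebra_simps)
    ultimately show ?thesis by (simp add: norm_mult power_mult_distrib mult_right_mono)
  qed
  hence "nsq n (\<lambda>m. evolve s v m - evolve t v m) \<le> (\<Sum>m<n. (L * \<bar>s - t\<bar>)\<^sup>2 * (cmod (v m))\<^sup>2)"
    unfolding nsq_def by (intro sum_mono) auto
  thus ?thesis by (simp add: nsq_def L_def sum_distrib_left)
qed

text \<open>
  The test vectors taken at time \<open>t\<close> give \<open>f t \<le> f s + \<epsilon>\<close>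
  as soon as \<open>s\<close> is within a distance of \<open>t\<close> that depends on
  \<open>\<epsilon>\<close> only, because the arcsine is uniformly continuous. By this
  uniformity \<open>s\<close> and \<open>t\<close> may be exchanged.
\<close>

lemma angle_sum_continuous:
  assumes pr: "\<And>t. \<exists>a. principal t (\<Theta> t) a" and r: "r \<le> k"
  shows "continuous_on A (\<lambda>t. \<Sum>l<r. \<Theta> t l)"
proof -
  define f where "f t = (\<Sum>l<r. \<Theta> t l)" for t
  define L where "L = (\<Sum>m<n. \<bar>lam m\<bar>)"
  have L0: "0 \<le> L" by (simp add: L_def sum_nonneg)
  have semi: "\<exists>\<delta>>0. \<forall>s t. \<bar>s - t\<bar> < \<delta> \<longrightarrow> f t \<le> f s + \<epsilon>" if \<epsilon>: "\<epsilon> > 0" for \<epsilon>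
  proof -
    obtain \<delta> where \<delta>: "\<delta> > 0"
      "\<And>x y. -1 \<le> x \<Longrightarrow> x \<le> 1 \<Longrightarrow> -1 \<le> y \<Longrightarrow> y \<le> 1 \<Longrightarrow> \<bar>x - y\<bar> < \<delta> \<Longrightarrow> \<bar>arcsin x - arcsin y\<bar> < \<epsilon> / (r + 1)"
      using arcsin_uniformly_continuous[of "\<epsilon> / (r + 1)"] \<epsilon> by auto
    show ?thesis
    proof (intro exI[of _ "\<delta> / (L + 1)"] conjI allI impI)
      show "\<delta> / (L + 1) > 0" using \<delta>(1) L0 by simp
      fix s t :: real assume st: "\<bar>s - t\<bar> < \<delta> / (L + 1)"
      hence "(L + 1) * \<bar>s - t\<bar> < \<delta>" using L0 by (simp add: field_simps)
      moreover have "L * \<bar>s - t\<bar> \<le> (L + 1) * \<bar>s - t\<bar>" by (intro mult_right_mono) auto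
      ultimately have st': "L * \<bar>s - t\<bar> < \<delta>" by simp
      obtain a where a: "principal t (\<Theta> t) a" using pr by blast
      obtain d where d: "principal s (\<Theta> s) d" using pr by blast
      define c where "c = normal_part t (\<Theta> t) a"
      have near: "\<Theta> t i - \<epsilon> / (r + 1) \<le> arcsin (Re (ip n (evolve s (a i)) (c i)))" if "i < r" for i
      proof -
        have i: "i < k" using that r by simp
        have ai: "nsq n (a i) = 1" using orthonormal_nsq[OF principalD(1)[OF a]] i by simp
        have ci: "nsq n (c i) \<le> 1" unfolding c_def by (rule normal_part_nsq_le[OF a i])
        have "(cmod (ip n (evolve s (a i)) (c i)))\<^sup>2 \<le> nsq n (evolve s (a i))" by (rule bessel_single[OF ci])
        also have "\<dots> = 1" using ip_self[of n "evolve s (a i)"] ip_self[of n "a i"] ai by simp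
        finally have "cmod (ip n (evolve s (a i)) (c i)) \<le> 1" by (simp add: abs_square_le_1)
        hence b1: "\<bar>Re (ip n (evolve s (a i)) (c i))\<bar> \<le> 1"
          using abs_Re_le_cmod[of "ip n (evolve s (a i)) (c i)"] by linarith
        have "(cmod (ip n (\<lambda>m. evolve s (a i) m - evolve t (a i) m) (c i)))\<^sup>2 \<le> (L * \<bar>s - t\<bar>)\<^sup>2"
          using order_trans[OF bessel_single[OF ci, of "\<lambda>m. evolve s (a i) m - evolve t (a i) m"] nsq_evolve_diff_le[of s "a i" t]]
          by (simp only: ai L_def mult_1_right)
        hence "cmod (ip n (\<lambda>m. evolve s (a i) m - evolve t (a i) m) (c i)) \<le> L * \<bar>s - t\<bar>"
          by (rule power2_le_imp_le) (use L0 in simp)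
        moreover have "ip n (\<lambda>m. evolve s (a i) m - evolve t (a i) m) (c i) = ip n (evolve s (a i)) (c i) - of_real (sin (\<Theta> t i))"
          by (simp add: ip_diff_left c_def ip_evolve_normal_part[OF a i])
        ultimately have "cmod (ip n (evolve s (a i)) (c i) - of_real (sin (\<Theta> t i))) \<le> L * \<bar>s - t\<bar>"
          by (simp only:)
        from order_trans[OF abs_Re_le_cmod this]
        have "\<bar>Re (ip n (evolve s (a i)) (c i)) - sin (\<Theta> t i)\<bar> \<le> L * \<bar>s - t\<bar>" by simp
        hence "\<bar>arcsin (Re (ip n (evolve s (a i)) (c i))) - arcsin (sin (\<Theta> t i))\<bar> < \<epsilon> / (r + 1)"
          using b1 st' by (intro \<delta>(2)) auto
        thus ?thesis by (simp add: arcsin_sin_angle[OF a i])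
      qed
      have "f t - r * (\<epsilon> / (r + 1)) = (\<Sum>i<r. \<Theta> t i - \<epsilon> / (r + 1))"
        by (simp add: f_def sum_subtractf)
      also have "\<dots> \<le> (\<Sum>i<r. arcsin (Re (ip n (evolve s (a i)) (c i))))" by (intro sum_mono near) simp
      also have "\<dots> \<le> f s" unfolding f_def c_def by (rule sum_arcsin_normal_part_le[OF a d r])
      finally have "f t \<le> f s + r * (\<epsilon> / (r + 1))" by simp
      moreover have "r * (\<epsilon> / (r + 1)) \<le> \<epsilon>" using \<epsilon> by (simp add: field_simps)
      ultimately show "f t \<le> f s + \<epsilon>" by simp
    qed
  qed
  have "continuous_on A f"
    unfolding continuous_on_iff
  proof (intro ballI allI impI)
    fix t \<epsilon> :: real assume "0 < \<epsilon>"
    then obtain \<delta> where \<delta>: "\<delta> > 0" "\<And>s t. \<bar>s - t\<bar> < \<delta> \<Longrightarrow> f t \<le> f s + \<epsilon> / 2"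
      using semi[of "\<epsilon> / 2"] by auto
    have "dist (f s) (f t) < \<epsilon>" if "dist s t < \<delta>" for s
      using \<delta>(2)[of s t] \<delta>(2)[of t s] that \<open>0 < \<epsilon>\<close> by (auto simp: dist_real_def abs_minus_commute)
    thus "\<exists>d>0. \<forall>x'\<in>A. dist x' t < d \<longrightarrow> dist (f x') (f t) < \<epsilon>" using \<delta>(1) by blast
  qed
  thus ?thesis by (simp add: f_def)
qed

lemma has_derivative_Re_ip_evolve:
  "((\<lambda>s. Re (ip n (evolve s x) y)) has_real_derivative - Im (ip n (\<lambda>m. of_real (lam m) * evolve t x m) y)) (at t)"
proof -
  have "((\<lambda>s. \<Sum>m<n. Re (cis (s * lam m) * (x m * cnj (y m)))) has_real_derivative
     (\<Sum>m<n. - lam m * Im (cis (t * lam m) * (x m * cnj (y m))))) (at t)"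
  proof (rule DERIV_sum)
    fix m
    show "((\<lambda>s. Re (cis (s * lam m) * (x m * cnj (y m)))) has_real_derivative
        - lam m * Im (cis (t * lam m) * (x m * cnj (y m)))) (at t)"
      by (auto intro!: derivative_eq_intros simp: algebra_simps)
  qed
  moreover have "(\<Sum>m<n. - lam m * Im (cis (t * lam m) * (x m * cnj (y m)))) =
      - Im (ip n (\<lambda>m. of_real (lam m) * evolve t x m) y)"
    by (simp only: Im_ip_weighted evolve_def mult.assoc sum_negf mult_minus_left)
  ultimately show ?thesis by (simp add: ip_def evolve_def mult.assoc)
qed

text \<open>
  The normal component contributes \<open>sin \<theta> \<langle>X c, c\<rangle>\<close>, which
  is real because \<open>X\<close> is Hermitian.
\<close>

lemma velocity_normal_part:
  assumes pr: "principal t \<theta> a" and i: "i < k"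
  shows "Im (ip n (\<lambda>m. of_real (lam m) * evolve t (a i) m) (normal_part t \<theta> a i))
    = Im (ip n (\<lambda>m. of_real (lam m) * proj (evolve t (a i)) m) (normal_part t \<theta> a i))"
proof -
  let ?c = "normal_part t \<theta> a i"
  have "ip n (\<lambda>m. of_real (lam m) * evolve t (a i) m) ?c =
     ip n (\<lambda>m. of_real (lam m) * proj (evolve t (a i)) m + of_real (sin (\<theta> i)) * (of_real (lam m) * ?c m)) ?c"
    by (intro ip_cong refl) (simp add: residual_eq_normal_part[OF pr i] algebra_simps)
  also have "\<dots> = ip n (\<lambda>m. of_real (lam m) * proj (evolve t (a i)) m) ?c
      + of_real (sin (\<theta> i)) * ip n (\<lambda>m. of_real (lam m) * ?c m) ?c"
    by (simp only: ip_add_left ip_scale_left)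
  also have "ip n (\<lambda>m. of_real (lam m) * ?c m) ?c = of_real (\<Sum>m<n. lam m * (cmod (?c m))\<^sup>2)"
    by (simp add: ip_def complex_norm_square mult.assoc del: of_real_power)
  finally show ?thesis by simp
qed

text \<open>
  The touching function is the sum of \<open>arcsin (Re \<langle>b\<^sub>i(s),
  c\<^sub>i\<rangle>)\<close> with \<open>c\<^sub>i\<close> frozen at time \<open>t\<close>. Its
  slope is \<open>- \<Sum> Im \<langle>X p\<^sub>i, c\<^sub>i\<rangle>\<close>: the factor
  \<open>cos \<theta>\<^sub>i\<close> in the projection of \<open>b\<^sub>i\<close> to
  \<open>S\<close> cancels the derivative \<open>1 / cos \<theta>\<^sub>i\<close> of the arcsine
  at \<open>sin \<theta>\<^sub>i\<close>. This cancellation is why right angles have to be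
  excluded.
\<close>

lemma touching_from_below:
  assumes pr: "\<And>t. \<exists>a. principal t (\<Theta> t) a" and r: "r \<le> k" and acute: "\<And>i. i < k \<Longrightarrow> cos (\<Theta> t i) \<noteq> 0"
  shows "\<exists>G G'. (G has_real_derivative G') (at t) \<and> G t = (\<Sum>l<r. \<Theta> t l)
    \<and> G' \<le> half_spread_sum n lam r \<and> (\<forall>s. G s \<le> (\<Sum>l<r. \<Theta> s l))"
proof -
  obtain a where a: "principal t (\<Theta> t) a" using pr by blast
  define c where "c = normal_part t (\<Theta> t) a"
  define p where "p i m = inverse (of_real (cos (\<Theta> t i))) * proj (evolve t (a i)) m" for i m
  define G where "G s = (\<Sum>i<r. arcsin (Re (ip n (evolve s (a i)) (c i))))" for s
  define v where "v i = - Im (ip n (\<lambda>m. of_real (lam m) * p i m) (c i))" for i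
  have "((\<lambda>s. arcsin (Re (ip n (evolve s (a i)) (c i)))) has_real_derivative v i) (at t)" if "i < r" for i
  proof -
    have i: "i < k" using that r by simp
    have ang: "0 \<le> \<Theta> t i" "\<Theta> t i \<le> pi / 2" using principalD(3,4)[OF a i] by auto
    have "\<Theta> t i \<noteq> pi / 2" using acute[OF i] cos_pi_half by metis
    hence lt: "\<Theta> t i < pi / 2" using ang by simp
    have val: "Re (ip n (evolve t (a i)) (c i)) = sin (\<Theta> t i)" by (simp add: c_def ip_evolve_normal_part[OF a i])
    have cpos: "0 < cos (\<Theta> t i)" using ang lt by (intro cos_gt_zero_pi) auto
    have s0: "0 \<le> sin (\<Theta> t i)" using ang by (intro sin_ge_zero) auto
    have "(sin (\<Theta> t i))\<^sup>2 < 1" using cpos by (simp add: sin_squared_eq)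
    hence s1: "sin (\<Theta> t i) < 1" by (metis one_power2 power2_less_imp_less zero_le_one)
    have "(arcsin has_real_derivative inverse (cos (\<Theta> t i))) (at (Re (ip n (evolve t (a i)) (c i))))"
      using DERIV_arcsin[of "sin (\<Theta> t i)"] s0 s1 cpos unfolding val by (simp flip: cos_squared_eq)
    from DERIV_chain2[OF this has_derivative_Re_ip_evolve[of "a i" "c i" t]]
    have "((\<lambda>s. arcsin (Re (ip n (evolve s (a i)) (c i)))) has_real_derivative
       inverse (cos (\<Theta> t i)) * - Im (ip n (\<lambda>m. of_real (lam m) * proj (evolve t (a i)) m) (c i))) (at t)"
      unfolding c_def velocity_normal_part[OF a i] .
    moreover have "v i = inverse (cos (\<Theta> t i)) * - Im (ip n (\<lambda>m. of_real (lam m) * proj (evolve t (a i)) m) (c i))"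
    proof -
      have "ip n (\<lambda>m. of_real (lam m) * p i m) (c i) =
         of_real (inverse (cos (\<Theta> t i))) * ip n (\<lambda>m. of_real (lam m) * proj (evolve t (a i)) m) (c i)"
        unfolding p_def ip_scale_left[symmetric] by (intro ip_cong) (auto simp: mult_ac)
      moreover have "Im (of_real x * z) = x * Im z" for x z by simp
      ultimately show ?thesis by (simp only: v_def mult_minus_right)
    qed
    ultimately show ?thesis by simp
  qed
  hence deriv: "(G has_real_derivative (\<Sum>i<r. v i)) (at t)"
    unfolding G_def by (intro DERIV_sum) auto
  \<comment> \<open>for vanishing angles the vector \<open>c i\<close> is zero and must leave the orthonormal family\<close>
  define J where "J = {i. i < r \<and> sin (\<Theta> t i) \<noteq> 0}"
  have J: "finite J" "card J \<le> r" "\<And>i. i \<in> J \<Longrightarrow> i < k"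
    using card_mono[of "{..<r}" J] r by (auto simp: J_def)
  have "(\<Sum>i<r. v i) = (\<Sum>i\<in>J. v i)"
    by (intro sum.mono_neutral_right) (auto simp: J_def v_def c_def normal_part_def ip_def)
  also have "\<dots> \<le> half_spread_sum n lam r"
    unfolding v_def
  proof (rule paired_form_le[OF J(1) _ _ _ lam_antimono J(2)])
    show "orthonormal n J p" unfolding orthonormal_def p_def ip_scale_left ip_scale_right
      using acute J(3) by (auto simp: principalD(6)[OF a] power2_eq_square field_simps)
    show "orthonormal n J c" unfolding orthonormal_def c_def
      using J(3) by (auto simp: normal_part_ip[OF a] J_def)
    show "ip n (p i) (c j) = 0" for i j
      unfolding p_def ip_scale_left c_def proj_normal_part by simp
  qed
  finally have "(\<Sum>i<r. v i) \<le> half_spread_sum n lam r" .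
  moreover have "G t = (\<Sum>l<r. \<Theta> t l)" unfolding G_def
    using r by (intro sum.cong refl) (simp add: c_def ip_evolve_normal_part[OF a] arcsin_sin_angle[OF a])
  moreover have "G s \<le> (\<Sum>l<r. \<Theta> s l)" for s
    using sum_arcsin_normal_part_le[OF a _ r] pr[of s] unfolding G_def c_def by blast
  ultimately show ?thesis using deriv by blast
qed

text \<open>
  A principal vector at a right angle to \<open>S\<close> has zero projection, and its
  coordinates are a kernel vector of the compression.
\<close>

lemma right_angle_singular:
  assumes pr: "principal t \<theta> a" and i: "i < k" and right: "cos (\<theta> i) = 0"
  shows "singular_time t"
  unfolding singular_time_def
proof (intro exI[of _ "\<lambda>l. ip n (a i) (e l)"] conjI allI impI)
  have ai: "a i = comb {..<k} (\<lambda>l. ip n (a i) (e l)) e"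
    using principal_in_subspace[OF pr i] by (simp add: proj_def)
  show "\<exists>l<k. ip n (a i) (e l) \<noteq> 0"
  proof (rule ccontr)
    assume "\<not> ?thesis"
    hence "ip n (proj (a i)) (a i) = 0" by (simp add: ip_proj_left)
    moreover have "ip n (proj (a i)) (a i) = 1"
      using orthonormal_ip[OF principalD(1)[OF pr], of i i] i by (simp add: principal_in_subspace[OF pr])
    ultimately show False by simp
  qed
  fix i' assume i': "i' < k"
  have "nsq n (proj (evolve t (a i))) = 0"
    using principalD(6)[OF pr i i] right by (simp add: ip_self)
  moreover have "nsq n (e i') \<le> 1" using orthonormal_nsq[OF basis] i' by simp
  ultimately have "ip n (proj (evolve t (a i))) (e i') = 0"
    using bessel_single[of n "e i'" "proj (evolve t (a i))"] by simp
  hence "ip n (evolve t (a i)) (e i') = 0" by (simp add: ip_proj_basis[OF i'])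
  thus "(\<Sum>l<k. ip n (a i) (e l) * ip n (evolve t (e l)) (e i')) = 0"
    using arg_cong[OF ai, of "\<lambda>v. ip n (evolve t v) (e i')"] by (simp only: evolve_comb ip_comb_left)
qed

theorem angle_sum_le:
  assumes pr: "\<And>t. \<exists>a. principal t (\<Theta> t) a" and r: "r \<le> k" and sing: "countable {t. singular_time t}"
  shows "(\<Sum>l<r. \<Theta> 1 l) \<le> half_spread_sum n lam r"
proof -
  have "\<Theta> 0 l = 0" if l: "l < k" for l
  proof -
    obtain a where a: "principal 0 (\<Theta> 0) a" using pr by blast
    have "evolve 0 v = v" for v by (simp add: evolve_def fun_eq_iff)
    hence "of_real ((cos (\<Theta> 0 l))\<^sup>2) = (1::complex)"
      using principalD(6)[OF a l l] orthonormal_ip[OF principalD(1)[OF a], of l l] l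
      by (simp add: principal_in_subspace[OF a])
    hence "(cos (\<Theta> 0 l))\<^sup>2 = 1" using of_real_eq_1_iff by blast
    hence "sin (\<Theta> 0 l) = 0" using sin_squared_eq[of "\<Theta> 0 l"] by simp
    thus ?thesis using arcsin_sin_angle[OF a l] by simp
  qed
  hence "(\<Sum>l<r. \<Theta> 0 l) = 0" using r by simp
  moreover have "(\<Sum>l<r. \<Theta> 1 l) \<le> (\<Sum>l<r. \<Theta> 0 l) + half_spread_sum n lam r"
  proof (rule le_of_lower_touching[where f = "\<lambda>t. \<Sum>l<r. \<Theta> t l", OF angle_sum_continuous[OF pr r] sing])
    fix t assume "t \<notin> {t. singular_time t}"
    hence "cos (\<Theta> t i) \<noteq> 0" if "i < k" for i
      using right_angle_singular[OF _ that] pr[of t] by blast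
    thus "\<exists>G G'. (G has_real_derivative G') (at t) \<and> G t = (\<Sum>l<r. \<Theta> t l)
      \<and> G' \<le> half_spread_sum n lam r \<and> (\<forall>s. G s \<le> (\<Sum>l<r. \<Theta> s l))"
      by (rule touching_from_below[OF pr r])
  qed
  ultimately show ?thesis by simp
qed

end

section \<open>Orthonormal bases\<close>

lemma comb_closed:
  assumes "finite I" "V (\<lambda>m. 0)" "\<And>v w. V v \<Longrightarrow> V w \<Longrightarrow> V (\<lambda>m. v m + w m)" "\<And>a v. V v \<Longrightarrow> V (\<lambda>m. a * v m)"
    and "\<And>i. i \<in> I \<Longrightarrow> V (e i)"
  shows "V (comb I a e)"
  using assms(1,5)
proof (induction I rule: finite_induct)
  case empty thus ?case using assms(2) by (simp add: comb_def[abs_def])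
next
  case (insert i I)
  have "comb (insert i I) a e = (\<lambda>m. a i * e i m + comb I a e m)"
    using insert by (simp add: comb_def fun_eq_iff)
  thus ?case using insert assms(3)[of "\<lambda>m. a i * e i m" "comb I a e"] assms(4)[of "e i" "a i"] by simp
qed

lemma orthonormal_comb_ip:
  assumes "finite I" "orthonormal n I e" "j \<in> I"
  shows "ip n (comb I a e) (e j) = a j"
proof -
  have "ip n (comb I a e) (e j) = (\<Sum>i\<in>I. if i = j then a i else 0)"
    unfolding ip_comb_left by (intro sum.cong refl) (simp add: orthonormal_ip[OF assms(2) _ assms(3)])
  thus ?thesis using assms by simp
qed

lemma ip_comb_comb:
  assumes "finite I" "orthonormal n I e"
  shows "ip n (comb I a e) (comb I b e) = (\<Sum>i\<in>I. a i * cnj (b i))"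
  unfolding ip_comb_right by (simp add: orthonormal_comb_ip[OF assms] mult.commute)

definition normalized :: "nat \<Rightarrow> (nat \<Rightarrow> complex) \<Rightarrow> nat \<Rightarrow> complex" where
  "normalized n w = (\<lambda>m. inverse (of_real (sqrt (nsq n w))) * w m)"

lemma orthonormal_extend:
  assumes e: "orthonormal n {..<k} e" and orth: "\<And>i. i < k \<Longrightarrow> ip n w (e i) = 0" and w: "nsq n w \<noteq> 0"
  shows "orthonormal n {..<Suc k} (e(k := normalized n w))"
proof -
  have orth': "ip n (e i) w = 0" if "i < k" for i
    using orth[OF that] by (metis complex_cnj_zero ip_cnj)
  define s where "s = sqrt (nsq n w)"
  have s: "nsq n w = s * s" "s \<noteq> 0" using w by (simp_all add: s_def)
  have "ip n (normalized n w) (normalized n w) = inverse (of_real s) * (inverse (of_real s) * of_real (nsq n w))"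
    by (simp add: normalized_def ip_scale_left ip_scale_right ip_self s_def)
  also have "\<dots> = 1" unfolding s(1) using s(2) by (simp add: field_simps)
  finally have self: "ip n (normalized n w) (normalized n w) = 1" .
  have "ip n (normalized n w) (e i) = 0" "ip n (e i) (normalized n w) = 0" if "i < k" for i
    using that by (simp_all add: normalized_def ip_scale_left ip_scale_right orth orth')
  thus ?thesis using self e by (auto simp: orthonormal_def less_Suc_eq)
qed

lemma residual_orthogonal:
  assumes "finite I" "orthonormal n I e" "j \<in> I"
  shows "ip n (\<lambda>m. v m - comb I (\<lambda>i. ip n v (e i)) e m) (e j) = 0"
  by (simp add: ip_diff_left orthonormal_comb_ip[OF assms])

lemma nsq_eq_0D: "nsq n w = 0 \<Longrightarrow> m < n \<Longrightarrow> w m = 0"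
  by (simp add: nsq_def sum_nonneg_eq_0_iff)

text \<open>
  Take an orthonormal family in the subspace of maximal size; Bessel's inequality bounds the
  size by \<open>n\<close>. A nonzero residual of a vector of the subspace could be normalized
  and added.
\<close>

lemma orthonormal_basis_exists:
  assumes V: "V (\<lambda>m. 0)" "\<And>v w. V v \<Longrightarrow> V w \<Longrightarrow> V (\<lambda>m. v m + w m)" "\<And>a v. V v \<Longrightarrow> V (\<lambda>m. a * v m)"
  obtains k :: nat and e where "orthonormal n {..<k} e" "\<And>i. i < k \<Longrightarrow> V (e i)"
    "\<And>v m. V v \<Longrightarrow> m < n \<Longrightarrow> v m = comb {..<k} (\<lambda>i. ip n v (e i)) e m"
proof -
  define P where "P k \<longleftrightarrow> (\<exists>e. orthonormal n {..<k} e \<and> (\<forall>i<k. V (e i)))" for k :: nat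
  have "P 0" by (simp add: P_def orthonormal_def)
  have bound: "k \<le> n" if "P k" for k
    using that orthonormal_weights(3)[of "{..<k}" n] by (auto simp: P_def)
  define k where "k = Greatest P"
  have "P k" unfolding k_def by (rule GreatestI_nat[of P 0 n]) (use \<open>P 0\<close> bound in auto)
  then obtain e where e: "orthonormal n {..<k} e" "\<And>i. i < k \<Longrightarrow> V (e i)" by (auto simp: P_def)
  show ?thesis
  proof (rule that[OF e])
    fix v m assume v: "V v" and m: "m < n"
    define w where "w = (\<lambda>m. v m - comb {..<k} (\<lambda>i. ip n v (e i)) e m)"
    have "V (comb {..<k} (\<lambda>i. ip n v (e i)) e)" by (rule comb_closed) (use V e in auto)
    from V(2)[OF v V(3)[OF this, of "-1"]] have Vw: "V w" by (simp add: w_def)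
    have "nsq n w = 0"
    proof (rule ccontr)
      assume w0: "nsq n w \<noteq> 0"
      have "orthonormal n {..<Suc k} (e(k := normalized n w))"
        by (rule orthonormal_extend[OF e(1) _ w0]) (simp add: w_def residual_orthogonal[OF _ e(1)])
      moreover have "V (normalized n w)" unfolding normalized_def by (rule V(3)[OF Vw])
      ultimately have "P (Suc k)" using e(2) unfolding P_def
        by (intro exI[of _ "e(k := normalized n w)"]) (simp add: less_Suc_eq)
      from Greatest_le_nat[of P, OF this bound] show False by (simp add: k_def)
    qed
    thus "v m = comb {..<k} (\<lambda>i. ip n v (e i)) e m" using nsq_eq_0D[of n w m] m by (simp add: w_def)
  qed
qed

text \<open>
  Otherwise the family could be extended to \<open>n + 1\<close> orthonormal vectors.
\<close>

lemma orthonormal_complete: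
  assumes q: "orthonormal n {..<n} q" and m: "m < n"
  shows "v m = comb {..<n} (\<lambda>l. ip n v (q l)) q m"
proof -
  define w where "w = (\<lambda>m. v m - comb {..<n} (\<lambda>i. ip n v (q i)) q m)"
  have "nsq n w = 0"
  proof (rule ccontr)
    assume w0: "nsq n w \<noteq> 0"
    have "orthonormal n {..<Suc n} (q(n := normalized n w))"
      by (rule orthonormal_extend[OF q _ w0]) (simp add: w_def residual_orthogonal[OF _ q])
    from orthonormal_weights(3)[OF _ this] show False by simp
  qed
  thus ?thesis using nsq_eq_0D[of n w m] m by (simp add: w_def)
qed

lemma orthonormal_resolution:
  assumes q: "orthonormal n {..<n} q" and "i < n" "j < n"
  shows "(\<Sum>l<n. q l i * cnj (q l j)) = (if i = j then 1 else 0)"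
  using orthonormal_complete[OF q assms(2), of "delta j"] assms
  by (simp add: comb_def ip_delta_left delta_def mult.commute split: if_splits)

lemma parseval:
  assumes q: "orthonormal n {..<n} q"
  shows "ip n (\<lambda>m. ip n x (q m)) (\<lambda>m. ip n y (q m)) = ip n x y"
proof -
  have "ip n x y = ip n (comb {..<n} (\<lambda>l. ip n x (q l)) q) (comb {..<n} (\<lambda>l. ip n y (q l)) q)"
    by (intro ip_cong orthonormal_complete[OF q])
  thus ?thesis by (simp add: ip_comb_comb[OF _ q] ip_def[of n "\<lambda>m. ip n x (q m)"])
qed

lemma orthonormal_comb:
  assumes b: "orthonormal n {..<k} b" and x: "orthonormal k I x"
  shows "orthonormal n I (\<lambda>l. comb {..<k} (x l) b)"
  using x unfolding orthonormal_def ip_comb_comb[OF finite_lessThan b] by (simp add: ip_def)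

text \<open>
  The map from coordinates to vectors is an isometry. Since dimension \<open>k\<close> has room
  for at most \<open>k\<close> orthonormal vectors, this bounds the size of an orthonormal
  family inside the span of \<open>k\<close> vectors.
\<close>

lemma orthonormal_coords:
  assumes e: "orthonormal n {..<k} e" and b: "orthonormal n I b"
    and eq: "\<And>l m. l \<in> I \<Longrightarrow> m < n \<Longrightarrow> b l m = comb {..<k} (y l) e m"
  shows "orthonormal k I y"
proof -
  have "ip k (y l) (y l') = ip n (b l) (b l')" if "l \<in> I" "l' \<in> I" for l l'
  proof -
    have "ip n (b l) (b l') = ip n (comb {..<k} (y l) e) (comb {..<k} (y l') e)"
      by (intro ip_cong eq that)
    thus ?thesis unfolding ip_comb_comb[OF finite_lessThan e] by (simp add: ip_def[of k])
  qed
  thus ?thesis using b by (simp add: orthonormal_def)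
qed

section \<open>Matrices with an orthonormal eigenbasis\<close>

text \<open>
  The \<open>q l\<close> are an orthonormal eigenbasis of \<open>A\<close> with eigenvalues
  \<open>\<mu> l\<close>.
\<close>

definition diagonalizes :: "nat \<Rightarrow> (nat \<Rightarrow> nat \<Rightarrow> complex) \<Rightarrow> (nat \<Rightarrow> complex) \<Rightarrow> complex mat \<Rightarrow> bool" where
  "diagonalizes n q \<mu> A \<longleftrightarrow> A \<in> carrier_mat n n \<and> orthonormal n {..<n} q \<and>
     (\<forall>l<n. \<forall>i<n. (\<Sum>j<n. A $$ (i, j) * q l j) = \<mu> l * q l i)"

lemma mult_mat_index:
  assumes "A \<in> carrier_mat n m" "B \<in> carrier_mat m k" "i < n" "j < k"
  shows "(A * B) $$ (i, j) = (\<Sum>l<m. A $$ (i, l) * B $$ (l, j))"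
  using assms by (simp add: scalar_prod_def atLeast0LessThan)

lemma mat_adjoint_index:
  assumes "A \<in> carrier_mat n m" "i < m" "j < n"
  shows "mat_adjoint A $$ (i, j) = cnj (A $$ (j, i))"
  using assms by (simp add: mat_adjoint_def mat_of_rows_index conjugate_complex_def)

lemma mat_adjoint_carrier [simp]: "A \<in> carrier_mat n m \<Longrightarrow> mat_adjoint A \<in> carrier_mat m n"
  by (auto simp: mat_adjoint_def)

lemma hermitian_mat_index:
  assumes "hermitian_mat n A" "i < n" "j < n" shows "cnj (A $$ (i, j)) = A $$ (j, i)"
  using assms mat_adjoint_index[of A n n j i] by (simp add: hermitian_mat_def)

lemma diagonalizes_index:
  assumes "diagonalizes n q \<mu> A" "i < n" "j < n"
  shows "A $$ (i, j) = (\<Sum>l<n. \<mu> l * q l i * cnj (q l j))"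
proof -
  have q: "orthonormal n {..<n} q" using assms(1) by (simp add: diagonalizes_def)
  have "(\<Sum>l<n. \<mu> l * q l i * cnj (q l j)) = (\<Sum>l<n. (\<Sum>m<n. A $$ (i, m) * q l m) * cnj (q l j))"
    using assms by (simp add: diagonalizes_def)
  also have "\<dots> = (\<Sum>m<n. A $$ (i, m) * (\<Sum>l<n. q l m * cnj (q l j)))"
    by (simp only: sum_distrib_left sum_distrib_right mult.assoc) (rule sum.swap)
  also have "\<dots> = (\<Sum>m<n. if m = j then A $$ (i, j) else 0)"
    by (intro sum.cong refl) (simp add: orthonormal_resolution[OF q] assms)
  also have "\<dots> = A $$ (i, j)" using assms by simp
  finally show ?thesis by simp
qed

lemma diagonalizes_unique:
  assumes A: "diagonalizes n q \<mu> A" and B: "diagonalizes n q \<mu> B" shows "A = B"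
proof (rule eq_matI)
  have c: "A \<in> carrier_mat n n" "B \<in> carrier_mat n n" using A B by (simp_all add: diagonalizes_def)
  thus "dim_row A = dim_row B" "dim_col A = dim_col B" by auto
  fix i j assume "i < dim_row B" "j < dim_col B"
  hence "i < n" "j < n" using c by auto
  thus "A $$ (i, j) = B $$ (i, j)" by (simp only: diagonalizes_index[OF A] diagonalizes_index[OF B])
qed

lemma diagonalizes_mult:
  assumes A: "diagonalizes n q \<mu> A" and B: "diagonalizes n q \<nu> B"
  shows "diagonalizes n q (\<lambda>l. \<mu> l * \<nu> l) (A * B)"
  unfolding diagonalizes_def
proof (intro conjI allI impI)
  have c: "A \<in> carrier_mat n n" "B \<in> carrier_mat n n" using A B by (auto simp: diagonalizes_def)
  thus "A * B \<in> carrier_mat n n" by simp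
  show "orthonormal n {..<n} q" using A by (simp add: diagonalizes_def)
  fix l i assume l: "l < n" and i: "i < n"
  have "(\<Sum>j<n. (A * B) $$ (i, j) * q l j) = (\<Sum>j<n. (\<Sum>m<n. A $$ (i, m) * B $$ (m, j)) * q l j)"
    using i by (intro sum.cong refl) (simp add: mult_mat_index[OF c] del: index_mult_mat)
  also have "\<dots> = (\<Sum>m<n. A $$ (i, m) * (\<Sum>j<n. B $$ (m, j) * q l j))"
    by (simp only: sum_distrib_left sum_distrib_right mult.assoc) (rule sum.swap)
  also have "\<dots> = (\<Sum>m<n. A $$ (i, m) * q l m) * \<nu> l"
    using B l by (simp add: diagonalizes_def sum_distrib_right sum_distrib_left mult_ac)
  also have "\<dots> = \<mu> l * \<nu> l * q l i" using A l i by (simp add: diagonalizes_def)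
  finally show "(\<Sum>j<n. (A * B) $$ (i, j) * q l j) = \<mu> l * \<nu> l * q l i" .
qed

definition spectral_mat :: "nat \<Rightarrow> (nat \<Rightarrow> nat \<Rightarrow> complex) \<Rightarrow> (nat \<Rightarrow> complex) \<Rightarrow> complex mat" where
  "spectral_mat n q \<mu> = mat n n (\<lambda>(i, j). \<Sum>l<n. \<mu> l * q l i * cnj (q l j))"

lemma diagonalizes_spectral_mat:
  assumes q: "orthonormal n {..<n} q" shows "diagonalizes n q \<mu> (spectral_mat n q \<mu>)"
  unfolding diagonalizes_def
proof (intro conjI allI impI q)
  show "spectral_mat n q \<mu> \<in> carrier_mat n n" by (simp add: spectral_mat_def)
  fix l i assume l: "l < n" and i: "i < n"
  have "(\<Sum>j<n. spectral_mat n q \<mu> $$ (i, j) * q l j) = (\<Sum>j<n. \<Sum>l'<n. \<mu> l' * q l' i * (q l j * cnj (q l' j)))"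
    using i by (simp add: spectral_mat_def sum_distrib_right sum_distrib_left mult_ac)
  also have "\<dots> = (\<Sum>l'<n. \<mu> l' * q l' i * ip n (q l) (q l'))"
    unfolding ip_def sum_distrib_left by (rule sum.swap)
  also have "\<dots> = (\<Sum>l'<n. if l' = l then \<mu> l * q l i else 0)"
    using l by (intro sum.cong refl) (simp add: orthonormal_ip[OF q])
  also have "\<dots> = \<mu> l * q l i" using l by simp
  finally show "(\<Sum>j<n. spectral_mat n q \<mu> $$ (i, j) * q l j) = \<mu> l * q l i" .
qed

lemma diagonalizes_one: "orthonormal n {..<n} q \<Longrightarrow> diagonalizes n q (\<lambda>l. 1) (1\<^sub>m n)"
  unfolding diagonalizes_def
  by (auto simp: if_distrib[of "\<lambda>z. z * _"] cong: if_cong)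

lemma diagonalizes_pow:
  assumes "diagonalizes n q \<mu> A" shows "diagonalizes n q (\<lambda>l. \<mu> l ^ k) (A ^\<^sub>m k)"
proof (induction k)
  case 0
  thus ?case using assms diagonalizes_one[of n q] by (auto simp: diagonalizes_def)
next
  case (Suc k)
  from diagonalizes_mult[OF Suc assms] show ?case by (simp add: mult.commute)
qed

lemma diagonalizes_exp:
  assumes A: "diagonalizes n q \<mu> A" shows "diagonalizes n q (\<lambda>l. exp (\<mu> l)) (mat_exp A)"
proof -
  have c: "A \<in> carrier_mat n n" and q: "orthonormal n {..<n} q" using A by (auto simp: diagonalizes_def)
  have "mat_exp A = spectral_mat n q (\<lambda>l. exp (\<mu> l))"
  proof (rule eq_matI)
    fix i j assume "i < dim_row (spectral_mat n q (\<lambda>l. exp (\<mu> l)))" "j < dim_col (spectral_mat n q (\<lambda>l. exp (\<mu> l)))"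
    hence ij: "i < n" "j < n" by (auto simp: spectral_mat_def)
    have "(\<lambda>k. \<Sum>l<n. (\<mu> l ^ k /\<^sub>R fact k) * (q l i * cnj (q l j))) sums (\<Sum>l<n. exp (\<mu> l) * (q l i * cnj (q l j)))"
      by (intro sums_sum sums_mult2 exp_converges)
    moreover have "(\<Sum>l<n. (\<mu> l ^ k /\<^sub>R fact k) * (q l i * cnj (q l j))) = (A ^\<^sub>m k) $$ (i, j) / fact k" for k
      unfolding diagonalizes_index[OF diagonalizes_pow[OF A] ij]
      by (simp add: sum_divide_distrib scaleR_conv_of_real field_simps)
    ultimately have "(\<lambda>k. (A ^\<^sub>m k) $$ (i, j) / fact k) sums (\<Sum>l<n. exp (\<mu> l) * (q l i * cnj (q l j)))" by simp
    thus "mat_exp A $$ (i, j) = spectral_mat n q (\<lambda>l. exp (\<mu> l)) $$ (i, j)"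
      using ij c by (simp add: mat_exp_def spectral_mat_def sums_iff mult.assoc)
  qed (use c in \<open>auto simp: mat_exp_def spectral_mat_def\<close>)
  thus ?thesis using diagonalizes_spectral_mat[OF q] by simp
qed

lemma ip_mat_adjoint:
  assumes herm: "\<And>i j. i < n \<Longrightarrow> j < n \<Longrightarrow> cnj (A i j) = A j i"
  shows "ip n (\<lambda>i. \<Sum>j<n. A i j * x j) y = ip n x (\<lambda>i. \<Sum>j<n. A i j * y j)"
proof -
  have "ip n (\<lambda>i. \<Sum>j<n. A i j * x j) y = (\<Sum>i<n. \<Sum>j<n. A i j * x j * cnj (y i))"
    by (simp add: ip_def sum_distrib_right)
  also have "\<dots> = (\<Sum>j<n. \<Sum>i<n. A i j * x j * cnj (y i))" by (rule sum.swap)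
  also have "\<dots> = ip n x (\<lambda>i. \<Sum>j<n. A i j * y j)"
    unfolding ip_def cnj_sum complex_cnj_mult sum_distrib_left
    by (intro sum.cong refl) (simp add: herm)
  finally show ?thesis .
qed

lemma eigenvector_exists:
  fixes B :: "nat \<Rightarrow> nat \<Rightarrow> complex"
  assumes "0 < k"
  obtains x \<mu> where "\<exists>i<k. x i \<noteq> 0" "\<And>i. i < k \<Longrightarrow> (\<Sum>j<k. B i j * x j) = \<mu> * x i"
proof -
  define M where "M = mat k k (\<lambda>(i, j). B i j)"
  have M: "M \<in> carrier_mat k k" by (simp add: M_def)
  have "degree (char_poly M) = k" using degree_monic_char_poly[OF M] by simp
  hence "\<not> constant (poly (char_poly M))" using assms by (simp add: constant_degree)
  then obtain \<mu> where "poly (char_poly M) \<mu> = 0" using fundamental_theorem_of_algebra by blast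
  hence "eigenvalue M \<mu>" using eigenvalue_root_char_poly[OF M] by simp
  then obtain v where v: "v \<in> carrier_vec k" "v \<noteq> 0\<^sub>v k" "M *\<^sub>v v = \<mu> \<cdot>\<^sub>v v"
    using M by (auto simp: eigenvalue_def eigenvector_def)
  show ?thesis
  proof (rule that)
    show "\<exists>i<k. vec_index v i \<noteq> 0" using v(1,2) by (metis carrier_vecD eq_vecI index_zero_vec)
    fix i assume i: "i < k"
    have "vec_index (M *\<^sub>v v) i = \<mu> * vec_index v i" using v i by simp
    thus "(\<Sum>j<k. B i j * vec_index v j) = \<mu> * vec_index v i"
      using v(1) i by (simp add: M_def scalar_prod_def atLeast0LessThan)
  qed
qed

section \<open>Spectral theorem and positive square roots\<close>

text \<open>
  A maximal orthonormal family of eigenvectors is a basis: otherwise its orthogonal complement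
  is a nonzero invariant subspace, the compression of \<open>A\<close> to it has an eigenvector,
  and by invariance this is an eigenvector of \<open>A\<close>.
\<close>

lemma hermitian_diagonalizable:
  assumes A: "hermitian_mat n A"
  shows "\<exists>q \<mu>. diagonalizes n q (\<lambda>l. of_real (\<mu> l)) A"
proof -
  have c: "A \<in> carrier_mat n n" using A by (simp add: hermitian_mat_def)
  define T where "T x = (\<lambda>i. \<Sum>j<n. A $$ (i, j) * x j)" for x :: "nat \<Rightarrow> complex"
  have adj: "ip n (T x) y = ip n x (T y)" for x y
    unfolding T_def by (rule ip_mat_adjoint) (simp add: hermitian_mat_index[OF A])
  have T_comb: "T (comb I a e) = comb I a (\<lambda>i. T (e i))" for I :: "nat set" and a e
    unfolding T_def comb_def fun_eq_iff sum_distrib_left by (subst sum.swap) (simp add: mult.left_commute)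
  define P where "P p \<longleftrightarrow> (\<exists>q \<mu>. orthonormal n {..<p} q \<and> (\<forall>l<p. \<forall>i<n. T (q l) i = of_real (\<mu> l) * q l i))" for p :: nat
  have "P 0" by (simp add: P_def orthonormal_def)
  have bound: "p \<le> n" if "P p" for p
    using that orthonormal_weights(3)[of "{..<p}" n] by (auto simp: P_def)
  define p where "p = Greatest P"
  have "P p" unfolding p_def by (rule GreatestI_nat[of P 0 n]) (use \<open>P 0\<close> bound in auto)
  then obtain q \<mu> where q: "orthonormal n {..<p} q"
    and ev: "\<And>l i. l < p \<Longrightarrow> i < n \<Longrightarrow> T (q l) i = of_real (\<mu> l) * q l i" by (auto simp: P_def)
  have "p = n"
  proof (rule ccontr)
    assume "p \<noteq> n"
    \<comment> \<open>the orthogonal complement of the eigenvectors found so far\<close>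
    define V where "V v \<longleftrightarrow> (\<forall>l<p. ip n v (q l) = 0)" for v
    have V: "V (\<lambda>m. 0)" "\<And>v w. V v \<Longrightarrow> V w \<Longrightarrow> V (\<lambda>m. v m + w m)" "\<And>a v. V v \<Longrightarrow> V (\<lambda>m. a * v m)"
      by (simp_all add: V_def ip_add_left ip_scale_left) (simp add: ip_def)
    have inv: "V (T v)" if "V v" for v
      unfolding V_def
    proof (intro allI impI)
      fix l assume l: "l < p"
      have "ip n (T v) (q l) = ip n v (\<lambda>m. of_real (\<mu> l) * q l m)"
        unfolding adj by (intro ip_cong refl ev l)
      thus "ip n (T v) (q l) = 0" using that l by (simp add: ip_scale_right V_def)
    qed
    obtain k :: nat and e where e: "orthonormal n {..<k} e" "\<And>i. i < k \<Longrightarrow> V (e i)"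
      and span: "\<And>v m. V v \<Longrightarrow> m < n \<Longrightarrow> v m = comb {..<k} (\<lambda>i. ip n v (e i)) e m"
      using orthonormal_basis_exists[of V n, OF V] by blast
    have "k \<noteq> 0"
    proof
      assume "k = 0"
      have one: "(\<Sum>l<p. (cmod (q l m))\<^sup>2) = 1" if m: "m < n" for m
      proof -
        define w where "w = (\<lambda>i. delta m i - comb {..<p} (\<lambda>l. ip n (delta m) (q l)) q i)"
        have "V w" unfolding V_def w_def by (simp add: residual_orthogonal[OF _ q])
        hence "w m = 0" using span[of w m] m \<open>k = 0\<close> by (simp add: comb_def)
        hence "complex_of_real (\<Sum>l<p. (cmod (q l m))\<^sup>2) = 1"
          using m by (simp add: w_def comb_def ip_delta_left delta_def complex_norm_square mult.commute del: of_real_power)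
        thus ?thesis using of_real_eq_1_iff by blast
      qed
      have "(\<Sum>m<n. \<Sum>l<p. (cmod (q l m))\<^sup>2) = n" using one by simp
      hence "p = n" using orthonormal_weights(2)[OF _ q] by simp
      thus False using \<open>p \<noteq> n\<close> by simp
    qed
    then obtain x \<nu> where x: "\<exists>i<k. x i \<noteq> 0"
      and ex: "\<And>i. i < k \<Longrightarrow> (\<Sum>j<k. ip n (T (e j)) (e i) * x j) = \<nu> * x i"
      using eigenvector_exists[of k "\<lambda>i j. ip n (T (e j)) (e i)"] by auto
    define w where "w = comb {..<k} x e"
    have Vw: "V w" unfolding w_def by (rule comb_closed) (use V e(2) in auto)
    have w: "nsq n w \<noteq> 0"
    proof
      assume "nsq n w = 0"
      hence "ip n w w = 0" by (simp add: ip_self)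
      moreover have "ip n w w = of_real (nsq k x)"
        unfolding w_def ip_comb_comb[OF finite_lessThan e(1)] using ip_self[of k x] by (simp add: ip_def)
      ultimately show False using x nsq_eq_0D[of k x] by auto
    qed
    have Tw: "T w m = \<nu> * w m" if m: "m < n" for m
    proof -
      have "ip n (T w) (e i) = \<nu> * x i" if "i < k" for i
        unfolding w_def T_comb ip_comb_left ex[OF that, symmetric] by (simp add: mult.commute)
      hence "comb {..<k} (\<lambda>i. ip n (T w) (e i)) e m = \<nu> * w m"
        by (simp add: comb_def w_def sum_distrib_left mult.assoc)
      thus ?thesis using span[OF inv[OF Vw] m] by simp
    qed
    have "ip n (T w) w = ip n (\<lambda>m. \<nu> * w m) w" "ip n w (T w) = ip n w (\<lambda>m. \<nu> * w m)"
      by (intro ip_cong Tw refl; assumption)+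
    hence "ip n (T w) w = \<nu> * ip n w w" "ip n w (T w) = cnj \<nu> * ip n w w"
      by (simp_all only: ip_scale_left ip_scale_right)
    hence "\<nu> = cnj \<nu>" using adj[of w w] w by (simp add: ip_self)
    hence \<nu>: "\<nu> = of_real (Re \<nu>)" by (metis Reals_cnj_iff of_real_Re)
    have "orthonormal n {..<Suc p} (q(p := normalized n w))"
      by (rule orthonormal_extend[OF q _ w]) (use Vw in \<open>simp add: V_def\<close>)
    moreover have "T (normalized n w) i = of_real (Re \<nu>) * normalized n w i" if "i < n" for i
    proof -
      have "T (normalized n w) i = inverse (of_real (sqrt (nsq n w))) * T w i"
        by (simp add: T_def normalized_def sum_distrib_left mult_ac)
      thus ?thesis using Tw[OF that] \<nu> by (simp add: normalized_def)
    qed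
    ultimately have "P (Suc p)" unfolding P_def using ev
      by (intro exI[of _ "q(p := normalized n w)"] exI[of _ "\<mu>(p := Re \<nu>)"]) (simp add: less_Suc_eq)
    from Greatest_le_nat[of P, OF this bound] show False by (simp add: p_def)
  qed
  hence "diagonalizes n q (\<lambda>l. of_real (\<mu> l)) A"
    using q ev c by (simp add: diagonalizes_def T_def)
  thus ?thesis by (intro exI)
qed

lemma diagonalizes_reorder:
  assumes "diagonalizes n q \<mu> A" and "inj_on \<pi> {..<n}" "\<pi> ` {..<n} \<subseteq> {..<n}"
  shows "diagonalizes n (\<lambda>l. q (\<pi> l)) (\<lambda>l. \<mu> (\<pi> l)) A"
proof -
  have "\<pi> l < n" if "l < n" for l using assms(3) that by auto
  moreover have "\<pi> l = \<pi> l' \<longleftrightarrow> l = l'" if "l < n" "l' < n" for l l'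
    using assms(2) that by (auto simp: inj_on_def)
  ultimately show ?thesis using assms(1) unfolding diagonalizes_def orthonormal_def by simp
qed

lemma hermitian_diagonalizable_sorted:
  assumes A: "hermitian_mat n A"
  obtains q \<mu> where "diagonalizes n q (\<lambda>l. of_real (\<mu> l)) A" "\<And>a b. a \<le> b \<Longrightarrow> b < n \<Longrightarrow> \<mu> b \<le> \<mu> a"
proof -
  obtain q \<mu> where d: "diagonalizes n q (\<lambda>l. of_real (\<mu> l)) A"
    using hermitian_diagonalizable[OF A] by metis
  define idx where "idx = sort_key (\<lambda>l. - \<mu> l) [0..<n]"
  have len: "length idx = n" and set: "set idx = {..<n}" and dist: "distinct idx"
    by (auto simp: idx_def)
  have sorted: "sorted (map (\<lambda>l. - \<mu> l) idx)" unfolding idx_def by (rule sorted_sort_key)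
  show ?thesis
  proof (rule that[of "\<lambda>l. q (idx ! l)" "\<lambda>l. \<mu> (idx ! l)"])
    show "diagonalizes n (\<lambda>l. q (idx ! l)) (\<lambda>l. of_real (\<mu> (idx ! l))) A"
    proof (rule diagonalizes_reorder[OF d])
      show "inj_on (\<lambda>l. idx ! l) {..<n}" using len dist by (intro inj_onI) (simp add: nth_eq_iff_index_eq)
      show "(\<lambda>l. idx ! l) ` {..<n} \<subseteq> {..<n}"
        using len set nth_mem[of _ idx] by auto
    qed
    show "\<mu> (idx ! b) \<le> \<mu> (idx ! a)" if "a \<le> b" "b < n" for a b
      using sorted_nth_mono[OF sorted that(1)] that len by simp
  qed
qed

lemma proots_linear_factors: "proots (\<Prod>a\<leftarrow>as. [:- a, 1:]) = mset (as :: complex list)"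
proof (induction as)
  case (Cons a as)
  have "(\<Prod>a\<leftarrow>as. [:- a, 1:]) \<noteq> 0" by (auto simp: prod_list_zero_iff)
  thus ?case using Cons by (simp add: proots_mult proots_linear_factor del: mult_pCons_left)
qed simp

definition cols_mat :: "nat \<Rightarrow> nat \<Rightarrow> (nat \<Rightarrow> nat \<Rightarrow> complex) \<Rightarrow> complex mat" where
  "cols_mat n k q = mat n k (\<lambda>(i, l). q l i)"

lemma cols_mat_carrier [simp]: "cols_mat n k q \<in> carrier_mat n k"
  by (simp add: cols_mat_def)

lemma adjoint_mult_index:
  assumes "A \<in> carrier_mat n k" "B \<in> carrier_mat n l" "i < k" "j < l"
  shows "(mat_adjoint A * B) $$ (i, j) = ip n (\<lambda>m. B $$ (m, j)) (\<lambda>m. A $$ (m, i))"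
  unfolding mult_mat_index[OF mat_adjoint_carrier[OF assms(1)] assms(2-4)] ip_def
  by (intro sum.cong refl) (simp add: mat_adjoint_index[OF assms(1,3)])

lemma isometry_iff:
  assumes "A \<in> carrier_mat n k"
  shows "mat_adjoint A * A = 1\<^sub>m k \<longleftrightarrow> orthonormal n {..<k} (\<lambda>i m. A $$ (m, i))"
proof -
  have "mat_adjoint A * A = 1\<^sub>m k \<longleftrightarrow> (\<forall>i<k. \<forall>j<k. (mat_adjoint A * A) $$ (i, j) = 1\<^sub>m k $$ (i, j))"
    using mult_carrier_mat[OF mat_adjoint_carrier[OF assms] assms] by (auto intro!: eq_matI)
  also have "\<dots> \<longleftrightarrow> orthonormal n {..<k} (\<lambda>i m. A $$ (m, i))"
    by (auto simp: adjoint_mult_index[OF assms assms] orthonormal_def simp del: index_mult_mat(1))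
  finally show ?thesis .
qed

text \<open>
  The eigenvector matrix is unitary and conjugates \<open>A\<close> to a diagonal matrix, so the
  roots of the characteristic polynomial are the \<open>\<mu> l\<close>.
\<close>

lemma eigvals_desc_eq:
  assumes A: "diagonalizes n q (\<lambda>l. of_real (\<mu> l)) A" and anti: "\<And>a b. a \<le> b \<Longrightarrow> b < n \<Longrightarrow> \<mu> b \<le> \<mu> a"
  shows "eigvals_desc A = map \<mu> [0..<n]"
proof -
  have c: "A \<in> carrier_mat n n" and q: "orthonormal n {..<n} q" using A by (auto simp: diagonalizes_def)
  define Q where "Q = cols_mat n n q"
  define D where "D = mat n n (\<lambda>(i, j). if i = j then complex_of_real (\<mu> i) else 0)"
  have Q: "Q \<in> carrier_mat n n" and D: "D \<in> carrier_mat n n" by (simp_all add: Q_def D_def)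
  have "orthonormal n {..<n} (\<lambda>i m. Q $$ (m, i))"
    using q unfolding orthonormal_def by (auto simp: Q_def cols_mat_def ip_def)
  hence inv: "mat_adjoint Q * Q = 1\<^sub>m n" using isometry_iff[OF Q] by simp
  hence inv': "Q * mat_adjoint Q = 1\<^sub>m n"
    using mat_mult_left_right_inverse[OF mat_adjoint_carrier[OF Q] Q] by simp
  have "A * Q = Q * D"
  proof (rule eq_matI)
    fix i j assume "i < dim_row (Q * D)" "j < dim_col (Q * D)"
    hence ij: "i < n" "j < n" using Q D by auto
    have "(A * Q) $$ (i, j) = (\<Sum>l<n. A $$ (i, l) * q j l)"
      unfolding mult_mat_index[OF c Q ij] using ij by (simp add: Q_def cols_mat_def)
    also have "\<dots> = of_real (\<mu> j) * q j i" using A ij by (simp add: diagonalizes_def)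
    also have "\<dots> = (\<Sum>l<n. if l = j then q j i * of_real (\<mu> j) else 0)" using ij by simp
    also have "\<dots> = (Q * D) $$ (i, j)"
      unfolding mult_mat_index[OF Q D ij] using ij
      by (intro sum.cong refl) (simp add: Q_def D_def cols_mat_def)
    finally show "(A * Q) $$ (i, j) = (Q * D) $$ (i, j)" .
  qed (use c Q D in auto)
  hence "A * Q * mat_adjoint Q = Q * D * mat_adjoint Q" by simp
  moreover have "A * Q * mat_adjoint Q = A"
    using assoc_mult_mat[OF c Q mat_adjoint_carrier[OF Q]] inv' c by simp
  ultimately have eq: "A = Q * D * mat_adjoint Q" by simp
  have dim: "dim_row A = n" using c by simp
  have "similar_mat_wit A D Q (mat_adjoint Q)"
    unfolding similar_mat_wit_def Let_def dim
    using c Q D mat_adjoint_carrier[OF Q] inv inv' eq by blast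
  hence "similar_mat A D" unfolding similar_mat_def by blast
  hence "char_poly A = char_poly D" by (rule char_poly_similar)
  also have "\<dots> = (\<Prod>a\<leftarrow>diag_mat D. [:- a, 1:])"
    by (rule char_poly_upper_triangular[OF D]) (auto simp: D_def upper_triangular_def)
  also have "diag_mat D = map (\<lambda>i. of_real (\<mu> i)) [0..<n]"
    by (auto simp: diag_mat_def D_def)
  finally have "proots (char_poly A) = mset (map (\<lambda>i. complex_of_real (\<mu> i)) [0..<n])"
    by (simp only: proots_linear_factors)
  hence "image_mset Re (proots (char_poly A)) = mset (rev (map \<mu> [0..<n]))"
    by (simp add: image_mset.compositionality o_def)
  hence "eigvals_desc A = rev (sort (rev (map \<mu> [0..<n])))"
    unfolding eigvals_desc_def by (simp only: sorted_list_of_multiset_mset)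
  moreover have "sorted (rev (map \<mu> [0..<n]))"
    by (auto simp: sorted_iff_nth_mono rev_nth intro!: anti)
  ultimately show ?thesis by (simp add: sorted_sort_id)
qed

lemma diagonalizes_apply:
  assumes A: "diagonalizes n q \<mu> A" and i: "i < n"
  shows "(\<Sum>j<n. A $$ (i, j) * x j) = comb {..<n} (\<lambda>l. \<mu> l * ip n x (q l)) q i"
proof -
  have "(\<Sum>j<n. A $$ (i, j) * x j) = (\<Sum>j<n. \<Sum>l<n. \<mu> l * q l i * (x j * cnj (q l j)))"
    using i by (intro sum.cong refl) (simp add: diagonalizes_index[OF A] sum_distrib_right sum_distrib_left mult_ac)
  also have "\<dots> = (\<Sum>l<n. \<mu> l * q l i * ip n x (q l))"
    unfolding ip_def sum_distrib_left by (rule sum.swap)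
  finally show ?thesis by (simp add: comb_def mult_ac)
qed

lemma hermitian_matI:
  assumes c: "A \<in> carrier_mat n n" and eq: "\<And>i j. i < n \<Longrightarrow> j < n \<Longrightarrow> cnj (A $$ (j, i)) = A $$ (i, j)"
  shows "hermitian_mat n A"
proof -
  have "mat_adjoint A = A"
  proof (rule eq_matI)
    fix i j assume "i < dim_row A" "j < dim_col A"
    hence "i < n" "j < n" using c by auto
    thus "mat_adjoint A $$ (i, j) = A $$ (i, j)" by (simp add: mat_adjoint_index[OF c] eq)
  qed (use carrier_matD[OF c] carrier_matD[OF mat_adjoint_carrier[OF c]] in simp_all)
  thus ?thesis using c by (simp add: hermitian_mat_def)
qed

lemma hermitian_spectral_mat: "hermitian_mat n (spectral_mat n q (\<lambda>l. of_real (\<mu> l)))"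
  by (rule hermitian_matI) (simp_all add: spectral_mat_def mult_ac)

lemma quadratic_form_eq_ip:
  assumes "A \<in> carrier_mat n n" "v \<in> carrier_vec n"
  shows "(A *\<^sub>v v) \<bullet>c v = ip n (\<lambda>i. \<Sum>j<n. A $$ (i, j) * vec_index v j) (vec_index v)"
  using assms by (simp add: scalar_prod_def ip_def atLeast0LessThan conjugate_complex_def)

lemma quadratic_form_diagonalized:
  assumes A: "diagonalizes n q (\<lambda>l. of_real (\<mu> l)) A"
  shows "ip n (\<lambda>i. \<Sum>j<n. A $$ (i, j) * x j) x = of_real (\<Sum>l<n. \<mu> l * (cmod (ip n x (q l)))\<^sup>2)"
proof -
  have q: "orthonormal n {..<n} q" using A by (auto simp: diagonalizes_def)
  have "ip n (\<lambda>i. \<Sum>j<n. A $$ (i, j) * x j) x = ip n (comb {..<n} (\<lambda>l. of_real (\<mu> l) * ip n x (q l)) q) x"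
    by (intro ip_cong diagonalizes_apply[OF A] refl)
  also have "\<dots> = of_real (\<Sum>l<n. \<mu> l * (cmod (ip n x (q l)))\<^sup>2)"
    unfolding ip_comb_left of_real_sum of_real_mult complex_norm_square by (simp add: ip_cnj mult.assoc del: of_real_power)
  finally show ?thesis .
qed

lemma psd_spectral_mat:
  assumes q: "orthonormal n {..<n} q" and \<mu>: "\<And>l. l < n \<Longrightarrow> 0 \<le> \<mu> l"
  shows "psd_mat n (spectral_mat n q (\<lambda>l. of_real (\<mu> l)))"
proof -
  have "0 \<le> (\<Sum>l<n. \<mu> l * (cmod (ip n (vec_index v) (q l)))\<^sup>2)" for v
    by (intro sum_nonneg mult_nonneg_nonneg) (auto simp: \<mu>)
  moreover have "spectral_mat n q (\<lambda>l. of_real (\<mu> l)) \<in> carrier_mat n n" by (simp add: spectral_mat_def)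
  ultimately show ?thesis
    by (simp add: psd_mat_def hermitian_spectral_mat quadratic_form_eq_ip
        quadratic_form_diagonalized[OF diagonalizes_spectral_mat[OF q]])
qed

lemma psd_eigenvalue_nonneg:
  assumes B: "psd_mat n B" and d: "diagonalizes n q (\<lambda>l. of_real (\<nu> l)) B" and l: "l < n"
  shows "0 \<le> \<nu> l"
proof -
  have q: "orthonormal n {..<n} q" and c: "B \<in> carrier_mat n n" using d by (auto simp: diagonalizes_def)
  define v where "v = vec n (q l)"
  have v: "v \<in> carrier_vec n" by (simp add: v_def)
  have "0 \<le> Re ((B *\<^sub>v v) \<bullet>c v)" using B v by (simp add: psd_mat_def)
  also have "(B *\<^sub>v v) \<bullet>c v = of_real (\<Sum>l'<n. \<nu> l' * (cmod (ip n (vec_index v) (q l')))\<^sup>2)"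
    by (simp only: quadratic_form_eq_ip[OF c v] quadratic_form_diagonalized[OF d])
  also have "(\<Sum>l'<n. \<nu> l' * (cmod (ip n (vec_index v) (q l')))\<^sup>2) = (\<Sum>l'<n. if l' = l then \<nu> l else 0)"
  proof (intro sum.cong refl)
    fix l' assume "l' \<in> {..<n}"
    moreover have "ip n (vec_index v) (q l') = ip n (q l) (q l')" by (intro ip_cong) (simp_all add: v_def)
    ultimately show "\<nu> l' * (cmod (ip n (vec_index v) (q l')))\<^sup>2 = (if l' = l then \<nu> l else 0)"
      using l by (simp add: orthonormal_ip[OF q])
  qed
  finally show ?thesis using l by simp
qed

text \<open>
  Uniqueness of the positive square root: let \<open>B\<close> be another one, with eigenbasis
  \<open>p\<close> and eigenvalues \<open>\<nu>\<close>. Then \<open>p l\<close> is an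
  eigenvector of \<open>M\<close> for \<open>(\<nu> l)\<^sup>2\<close>, hence orthogonal to
  every \<open>q m\<close> with \<open>\<mu> m \<noteq> (\<nu> l)\<^sup>2\<close>. So on
  \<open>p l\<close> the root built from \<open>q\<close> also acts as the scalar \<open>\<nu>
  l\<close>.
\<close>

lemma diagonalizes_mat_sqrt:
  assumes M: "diagonalizes n q (\<lambda>l. of_real (\<mu> l)) M" and \<mu>: "\<And>l. l < n \<Longrightarrow> 0 \<le> \<mu> l"
  shows "diagonalizes n q (\<lambda>l. of_real (sqrt (\<mu> l))) (mat_sqrt M)"
proof -
  have q: "orthonormal n {..<n} q" and c: "M \<in> carrier_mat n n" using M by (auto simp: diagonalizes_def)
  define R where "R = spectral_mat n q (\<lambda>l. of_real (sqrt (\<mu> l)))"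
  have dR: "diagonalizes n q (\<lambda>l. of_real (sqrt (\<mu> l))) R"
    unfolding R_def by (rule diagonalizes_spectral_mat[OF q])
  have psdR: "psd_mat n R" unfolding R_def by (rule psd_spectral_mat[OF q]) (simp add: \<mu>)
  have "diagonalizes n q (\<lambda>l. of_real (\<mu> l)) (R * R)"
    using diagonalizes_mult[OF dR dR] \<mu> by (auto simp: diagonalizes_def simp flip: of_real_mult)
  hence RR: "R * R = M" using M by (rule diagonalizes_unique)
  have "mat_sqrt M = R"
    unfolding mat_sqrt_def
  proof (rule the_equality)
    show "psd_mat (dim_row M) R \<and> R * R = M" using psdR RR c by simp
    fix B assume "psd_mat (dim_row M) B \<and> B * B = M"
    hence B: "psd_mat n B" and BB: "B * B = M" using c by auto
    obtain p \<nu> where dB: "diagonalizes n p (\<lambda>l. of_real (\<nu> l)) B"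
      using hermitian_diagonalizable B unfolding psd_mat_def by blast
    have p: "orthonormal n {..<n} p" using dB by (auto simp: diagonalizes_def)
    have \<nu>0: "0 \<le> \<nu> l" if "l < n" for l by (rule psd_eigenvalue_nonneg[OF B dB that])
    have dM: "diagonalizes n p (\<lambda>l. of_real (\<nu> l) * of_real (\<nu> l)) M"
      using diagonalizes_mult[OF dB dB] BB by simp
    have herm: "cnj (M $$ (i, j)) = M $$ (j, i)" if "i < n" "j < n" for i j
      using that by (simp add: diagonalizes_index[OF M] mult_ac)
    have match: "ip n (p l) (q m) = 0 \<or> sqrt (\<mu> m) = \<nu> l" if l: "l < n" and m: "m < n" for l m
    proof -
      have "of_real (\<nu> l * \<nu> l) * ip n (p l) (q m) = ip n (\<lambda>i. \<Sum>j<n. M $$ (i, j) * p l j) (q m)"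
        unfolding ip_scale_left[symmetric] using dM l by (intro ip_cong) (simp_all add: diagonalizes_def)
      also have "\<dots> = ip n (p l) (\<lambda>i. \<Sum>j<n. M $$ (i, j) * q m j)"
        by (rule ip_mat_adjoint) (simp add: herm)
      also have "\<dots> = ip n (p l) (\<lambda>i. of_real (\<mu> m) * q m i)"
        using M m by (intro ip_cong) (simp_all add: diagonalizes_def)
      also have "\<dots> = of_real (\<mu> m) * ip n (p l) (q m)" by (simp add: ip_scale_right)
      finally have "ip n (p l) (q m) = 0 \<or> complex_of_real (\<nu> l * \<nu> l) = of_real (\<mu> m)" by simp
      thus ?thesis using \<nu>0[OF l] by (auto simp only: of_real_eq_iff) (metis real_sqrt_abs2 abs_of_nonneg)
    qed
    have "diagonalizes n p (\<lambda>l. of_real (\<nu> l)) R"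
      unfolding diagonalizes_def
    proof (intro conjI allI impI p)
      show "R \<in> carrier_mat n n" by (simp add: R_def spectral_mat_def)
      fix l i assume l: "l < n" and i: "i < n"
      have "(\<Sum>j<n. R $$ (i, j) * p l j) = (\<Sum>m<n. of_real (sqrt (\<mu> m)) * ip n (p l) (q m) * q m i)"
        unfolding diagonalizes_apply[OF dR i] comb_def ..
      also have "\<dots> = (\<Sum>m<n. of_real (\<nu> l) * (ip n (p l) (q m) * q m i))"
        using match[OF l] by (intro sum.cong refl) (auto simp: mult_ac)
      also have "\<dots> = of_real (\<nu> l) * p l i"
        using orthonormal_complete[OF q i, of "p l"] by (simp add: comb_def flip: sum_distrib_left)
      finally show "(\<Sum>j<n. R $$ (i, j) * p l j) = of_real (\<nu> l) * p l i" .
    qed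
    thus "B = R" by (rule diagonalizes_unique[OF dB])
  qed
  thus ?thesis using dR by simp
qed

section \<open>Principal vectors from Gram matrices\<close>

context rotating_subspace
begin

text \<open>
  The coordinates of \<open>b\<close> with respect to \<open>e\<close> form \<open>k\<close>
  orthonormal vectors in dimension \<open>k\<close>, hence a complete system.
\<close>

lemma subspace_family_spans:
  assumes b: "orthonormal n {..<k} b" "\<forall>i<k. proj (b i) = b i"
  shows "proj v = comb {..<k} (\<lambda>l. ip n v (b l)) b"
proof -
  define y where "y = (\<lambda>l i. ip n (b l) (e i))"
  have by_eq: "b l = comb {..<k} (y l) e" if "l < k" for l
    using b(2) that by (simp add: proj_def y_def)
  have y: "orthonormal k {..<k} y"
    by (rule orthonormal_coords[OF basis b(1)]) (simp add: by_eq[symmetric])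
  define c where "c i = ip n v (e i)" for i
  have cy: "ip k c (y l) = ip n v (b l)" if "l < k" for l
    by (subst by_eq[OF that]) (simp add: ip_comb_right ip_def[of k] c_def mult.commute)
  have c: "c i = (\<Sum>l<k. ip n v (b l) * y l i)" if "i < k" for i
    using orthonormal_complete[OF y that, of c] by (simp add: comb_def cy)
  have "proj v m = comb {..<k} (\<lambda>l. ip n v (b l)) b m" for m
  proof -
    have "proj v m = (\<Sum>i<k. c i * e i m)" by (simp add: proj_def comb_def c_def)
    also have "\<dots> = (\<Sum>i<k. \<Sum>l<k. ip n v (b l) * (y l i * e i m))"
      using c by (simp add: sum_distrib_right mult.assoc)
    also have "\<dots> = (\<Sum>l<k. ip n v (b l) * comb {..<k} (y l) e m)"
      unfolding comb_def sum_distrib_left by (rule sum.swap)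
    also have "\<dots> = (\<Sum>l<k. ip n v (b l) * b l m)"
      by (intro sum.cong refl) (simp add: by_eq[symmetric])
    finally show ?thesis by (simp add: comb_def)
  qed
  thus ?thesis by (simp add: fun_eq_iff)
qed

lemma nsq_proj_le: "nsq n (proj v) \<le> nsq n v"
proof -
  have "complex_of_real (nsq n (proj v)) = of_real (\<Sum>i<k. (cmod (ip n v (e i)))\<^sup>2)"
    unfolding ip_self[symmetric] of_real_sum complex_norm_square proj_def
    by (rule ip_comb_comb[OF _ basis]) simp
  hence "nsq n (proj v) = (\<Sum>i<k. (cmod (ip n v (e i)))\<^sup>2)" using of_real_eq_iff by blast
  thus ?thesis using bessel_orthonormal[OF _ basis] by simp
qed

lemma proj_comb: "proj (comb I x b) = comb I x (\<lambda>i. proj (b i))"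
  unfolding proj_def comb_def[of "{..<k}"] fun_eq_iff ip_comb_left
  unfolding comb_def sum_distrib_left sum_distrib_right
  by (subst sum.swap) (simp add: mult.assoc)

text \<open>
  For an orthonormal basis \<open>b\<close> of \<open>S\<close> this is the matrix of
  \<open>C\<^sup>* C\<close>, where \<open>C\<close> is the compression to \<open>S\<close> of
  the unitary at time \<open>t\<close>.
\<close>

definition gram :: "real \<Rightarrow> (nat \<Rightarrow> nat \<Rightarrow> complex) \<Rightarrow> complex mat" where
  "gram t b = mat k k (\<lambda>(l, l'). ip n (proj (evolve t (b l'))) (proj (evolve t (b l))))"

lemma hermitian_gram: "hermitian_mat k (gram t b)"
  by (rule hermitian_matI) (simp_all add: gram_def ip_cnj)

lemma gram_eigenvectors:
  assumes b: "orthonormal n {..<k} b" "\<forall>i<k. proj (b i) = b i"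
    and d: "diagonalizes k x (\<lambda>l. of_real (\<mu> l)) (gram t b)"
  defines "a \<equiv> \<lambda>l. comb {..<k} (x l) b"
  shows "orthonormal n {..<k} a" "l < k \<Longrightarrow> proj (a l) = a l"
    "l < k \<Longrightarrow> l' < k \<Longrightarrow> ip n (proj (evolve t (a l))) (proj (evolve t (a l'))) = (if l = l' then of_real (\<mu> l) else 0)"
    "l < k \<Longrightarrow> 0 \<le> \<mu> l" "l < k \<Longrightarrow> \<mu> l \<le> 1"
proof -
  have x: "orthonormal k {..<k} x" using d by (simp add: diagonalizes_def)
  show a: "orthonormal n {..<k} a" unfolding a_def by (rule orthonormal_comb[OF b(1) x])
  show "proj (a l) = a l" if "l < k" for l
    unfolding a_def proj_comb by (simp add: comb_def fun_eq_iff b(2))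
  have form: "ip n (proj (evolve t (a l))) (proj (evolve t (a l'))) = (if l = l' then of_real (\<mu> l) else 0)"
    if l: "l < k" "l' < k" for l l'
  proof -
    have "ip n (proj (evolve t (a l))) (proj (evolve t (a l')))
      = (\<Sum>j<k. cnj (x l' j) * (\<Sum>i<k. x l i * ip n (proj (evolve t (b i))) (proj (evolve t (b j)))))"
      unfolding a_def evolve_comb proj_comb ip_comb_right ip_comb_left ..
    also have "\<dots> = (\<Sum>j<k. cnj (x l' j) * (\<Sum>i<k. gram t b $$ (j, i) * x l i))"
      by (intro sum.cong refl) (simp add: gram_def mult.commute)
    also have "\<dots> = (\<Sum>j<k. cnj (x l' j) * (of_real (\<mu> l) * x l j))"
      using d l by (simp add: diagonalizes_def)
    also have "\<dots> = of_real (\<mu> l) * ip k (x l) (x l')"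
      by (simp add: ip_def sum_distrib_left mult_ac)
    finally show ?thesis using l by (simp add: orthonormal_ip[OF x])
  qed
  thus "l < k \<Longrightarrow> l' < k \<Longrightarrow> ip n (proj (evolve t (a l))) (proj (evolve t (a l'))) = (if l = l' then of_real (\<mu> l) else 0)"
    for l l' .
  have \<mu>: "\<mu> l = nsq n (proj (evolve t (a l)))" if "l < k" for l
  proof -
    have "complex_of_real (nsq n (proj (evolve t (a l)))) = of_real (\<mu> l)"
      using form[OF that that] by (simp add: ip_self)
    thus ?thesis using of_real_eq_iff by metis
  qed
  show "0 \<le> \<mu> l" if "l < k" for l using \<mu>[OF that] by simp
  show "\<mu> l \<le> 1" if "l < k" for l
  proof -
    have "nsq n (evolve t (a l)) = 1"
      using ip_self[of n "evolve t (a l)"] orthonormal_ip[OF a, of l l] that by simp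
    thus ?thesis using \<mu>[OF that] nsq_proj_le[of "evolve t (a l)"] by simp
  qed
qed

text \<open>
  Eigenvectors of the Gram matrix, used as coefficients, give principal vectors; the eigenvalues
  are the squared cosines. The index is reversed because large angles belong to small
  eigenvalues.
\<close>

lemma principal_gram:
  assumes b: "orthonormal n {..<k} b" "\<forall>i<k. proj (b i) = b i"
    and d: "diagonalizes k x (\<lambda>l. of_real (\<mu> l)) (gram t b)"
    and anti: "\<And>i j. i \<le> j \<Longrightarrow> j < k \<Longrightarrow> \<mu> j \<le> \<mu> i"
  shows "\<exists>a. principal t (\<lambda>l. arccos (sqrt (\<mu> (k - 1 - l)))) a"
proof -
  define a where "a l = comb {..<k} (x l) b" for l
  note g = gram_eigenvectors[OF b d, folded a_def]
  define a' where "a' l = a (k - 1 - l)" for l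
  have r: "k - 1 - l < k" if "l < k" for l using that by simp
  have inj: "k - 1 - l = k - 1 - l' \<longleftrightarrow> l = l'" if "l < k" "l' < k" for l l' using that by arith
  have sub: "proj (a' l) = a' l" if "l < k" for l using g(2) r[OF that] by (simp add: a'_def)
  have on: "orthonormal n {..<k} a'"
    using g(1) r inj by (auto simp: orthonormal_def a'_def)
  show ?thesis
    unfolding principal_def
  proof (intro exI[of _ a'] conjI allI impI on subspace_family_spans sub)
    fix i j assume ij: "i < k" "j < k"
    have "0 \<le> \<mu> (k - 1 - i)" "\<mu> (k - 1 - i) \<le> 1" using g(4,5) r[OF ij(1)] by auto
    hence "(cos (arccos (sqrt (\<mu> (k - 1 - i)))))\<^sup>2 = \<mu> (k - 1 - i)" by (subst cos_arccos) (auto intro: order_trans[of _ 0])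
    thus "ip n (proj (evolve t (a' i))) (proj (evolve t (a' j))) =
      (if i = j then of_real ((cos (arccos (sqrt (\<mu> (k - 1 - i)))))\<^sup>2) else 0)"
      unfolding a'_def g(3)[OF r[OF ij(1)] r[OF ij(2)]] inj[OF ij] by (simp only:)
  next
    fix i assume i: "i < k"
    have "0 \<le> \<mu> (k - 1 - i)" "\<mu> (k - 1 - i) \<le> 1" using g(4,5) r[OF i] by auto
    thus "0 \<le> arccos (sqrt (\<mu> (k - 1 - i)))" "arccos (sqrt (\<mu> (k - 1 - i))) \<le> pi / 2"
      using arccos_lbound[of "sqrt (\<mu> (k - 1 - i))"] arccos_le_pi2[of "sqrt (\<mu> (k - 1 - i))"]
        real_sqrt_ge_zero[of "\<mu> (k - 1 - i)"] real_sqrt_le_1_iff[of "\<mu> (k - 1 - i)"]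
      by linarith+
  next
    fix i j :: nat assume ij: "i \<le> j" "j < k"
    have "0 \<le> \<mu> (k - 1 - i)" "\<mu> (k - 1 - j) \<le> 1" using g(4,5) r ij by auto
    moreover have "\<mu> (k - 1 - i) \<le> \<mu> (k - 1 - j)" using ij by (intro anti) auto
    ultimately show "arccos (sqrt (\<mu> (k - 1 - j))) \<le> arccos (sqrt (\<mu> (k - 1 - i)))"
      by (intro arccos_le_arccos) (auto intro: order_trans[of _ 0])
  qed
qed

lemma proj_basis: "i < k \<Longrightarrow> proj (e i) = e i"
  by (simp add: proj_def comb_def fun_eq_iff orthonormal_ip[OF basis] if_distrib[of "\<lambda>z. z * _"] cong: if_cong)

text \<open>
  The determinant of the compression extends to an entire function of a complex time variable,
  equal to \<open>1\<close> at time \<open>0\<close>. Its zero set is countable and contains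
  every singular time.
\<close>

lemma countable_singular_times: "countable {t. singular_time t}"
proof -
  define C where "C z = mat k k (\<lambda>(i, l). \<Sum>m<n. exp (\<i> * z * of_real (lam m)) * (e l m * cnj (e i m)))" for z :: complex
  define h where "h z = Determinant.det (C z)" for z
  have C: "C z \<in> carrier_mat k k" for z by (simp add: C_def)
  have hol: "h holomorphic_on UNIV"
  proof -
    have "h = (\<lambda>z. \<Sum>p | p permutes {0..<k}. of_int (sign p) *
       (\<Prod>i = 0..<k. \<Sum>m<n. exp (\<i> * z * of_real (lam m)) * (e (p i) m * cnj (e i m))))"
    proof
      fix z
      show "h z = (\<Sum>p | p permutes {0..<k}. of_int (sign p) *
         (\<Prod>i = 0..<k. \<Sum>m<n. exp (\<i> * z * of_real (lam m)) * (e (p i) m * cnj (e i m))))"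
        unfolding h_def det_def'[OF C]
      proof (intro sum.cong refl)
        fix p assume "p \<in> {p. p permutes {0..<k}}"
        hence "p i < k" if "i < k" for i using permutes_in_image[of p "{0..<k}" i] that by simp
        hence "(\<Prod>i = 0..<k. C z $$ (i, p i)) =
            (\<Prod>i = 0..<k. \<Sum>m<n. exp (\<i> * z * of_real (lam m)) * (e (p i) m * cnj (e i m)))"
          by (intro prod.cong refl) (simp add: C_def)
        thus "of_int (sign p) * (\<Prod>i = 0..<k. C z $$ (i, p i)) = of_int (sign p) *
            (\<Prod>i = 0..<k. \<Sum>m<n. exp (\<i> * z * of_real (lam m)) * (e (p i) m * cnj (e i m)))"
          by simp
      qed
    qed
    thus ?thesis by (auto intro!: holomorphic_intros)
  qed
  have "C 0 = 1\<^sub>m k"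
  proof (rule eq_matI)
    fix i j assume "i < dim_row (1\<^sub>m k)" "j < dim_col (1\<^sub>m k)"
    thus "C 0 $$ (i, j) = 1\<^sub>m k $$ (i, j)"
      using orthonormal_ip[OF basis, of j i] by (cases "i = j") (simp_all add: C_def ip_def)
  qed (simp_all add: C_def)
  hence h0: "h 0 = 1" by (simp add: h_def)
  have "countable {z. h z = 0}"
  proof (cases "h constant_on UNIV")
    case True
    hence "h z = 1" for z using h0 by (auto simp: constant_on_def)
    thus ?thesis by simp
  next
    case False
    from holomorphic_countable_zeros[OF hol _ convex_connected[OF convex_UNIV] _ False] show ?thesis by simp
  qed
  moreover have "complex_of_real ` {t. singular_time t} \<subseteq> {z. h z = 0}"
  proof safe
    fix t assume "singular_time t"
    then obtain x where x: "\<exists>l<k. x l \<noteq> 0" "\<And>i. i < k \<Longrightarrow> (\<Sum>l<k. x l * ip n (evolve t (e l)) (e i)) = 0"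
      by (auto simp: singular_time_def)
    define v where "v = vec k x"
    have v: "v \<in> carrier_vec k" "v \<noteq> 0\<^sub>v k"
      using x(1) by (auto simp: v_def dest: arg_cong[of _ _ "\<lambda>w. vec_index w _"]) (metis index_vec index_zero_vec(1))
    have "C (of_real t) *\<^sub>v v = 0\<^sub>v k"
    proof (rule eq_vecI)
      fix i assume "i < dim_vec (0\<^sub>v k)"
      hence i: "i < k" by simp
      have "C (of_real t) $$ (i, l) = ip n (evolve t (e l)) (e i)" if "l < k" for l
        using that i by (simp add: C_def ip_def evolve_def cis_conv_exp mult.assoc)
      hence "vec_index (C (of_real t) *\<^sub>v v) i = (\<Sum>l<k. ip n (evolve t (e l)) (e i) * x l)"
        using i C[of "of_real t"] by (simp add: scalar_prod_def v_def atLeast0LessThan)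
      thus "vec_index (C (of_real t) *\<^sub>v v) i = vec_index (0\<^sub>v k) i"
        using x(2)[OF i] i by (simp add: mult.commute)
    qed (use carrier_matD[OF C[of "of_real t"]] in simp)
    thus "h (of_real t) = 0" unfolding h_def det_0_iff_vec_prod_zero[OF C] using v by blast
  qed
  ultimately have "countable (complex_of_real ` {t. singular_time t})" using countable_subset by blast
  thus ?thesis by (rule countable_image_inj_on) (simp add: inj_on_def)
qed

text \<open>
  Only the time \<open>1\<close> matters for the conclusion, so there an arbitrary orthonormal
  basis \<open>b\<close> of \<open>S\<close> may be used; at other times \<open>e\<close>
  serves.
\<close>

theorem top_angle_sum_le:
  assumes b: "orthonormal n {..<k} b" "\<forall>i<k. proj (b i) = b i"
    and d: "diagonalizes k x (\<lambda>l. of_real (\<mu> l)) (gram 1 b)"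
    and anti: "\<And>i j. i \<le> j \<Longrightarrow> j < k \<Longrightarrow> \<mu> j \<le> \<mu> i"
    and r: "r \<le> k"
  shows "(\<Sum>l<r. arccos (sqrt (\<mu> (k - 1 - l)))) \<le> half_spread_sum n lam r"
proof -
  have "\<exists>\<theta> a. principal t \<theta> a" for t
    using hermitian_diagonalizable_sorted[OF hermitian_gram[of t e]] principal_gram[OF basis, of _ _ t] proj_basis by metis
  then obtain \<Theta>' where \<Theta>': "\<And>t. \<exists>a. principal t (\<Theta>' t) a" by metis
  define \<Theta> where "\<Theta> = \<Theta>'(1 := (\<lambda>l. arccos (sqrt (\<mu> (k - 1 - l)))))"
  have "\<exists>a. principal t (\<Theta> t) a" for t
    using \<Theta>'[of t] principal_gram[OF b d anti] by (simp add: \<Theta>_def)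
  from angle_sum_le[OF this r countable_singular_times] show ?thesis by (simp add: \<Theta>_def)
qed

end

section \<open>Isometries onto subspaces and the inequality for principal angles\<close>

lemma subspace_closed:
  assumes S: "VectorSpace.subspace class_ring S (module_vec TYPE(complex) n)"
  shows "S \<subseteq> carrier_vec n" "0\<^sub>v n \<in> S" "v \<in> S \<Longrightarrow> w \<in> S \<Longrightarrow> v + w \<in> S" "v \<in> S \<Longrightarrow> a \<cdot>\<^sub>v v \<in> S"
  using S unfolding VectorSpace.subspace_def submodule_def by (auto simp: module_vec_def)

lemma mult_mat_vec_index:
  assumes "A \<in> carrier_mat n k" "v \<in> carrier_vec k" "i < n"
  shows "vec_index (A *\<^sub>v v) i = comb {..<k} (vec_index v) (\<lambda>l m. A $$ (m, l)) i"
  using assms by (simp add: comb_def scalar_prod_def atLeast0LessThan mult.commute)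

lemma isometry_onto_exists:
  assumes S: "VectorSpace.subspace class_ring S (module_vec TYPE(complex) n)"
  shows "\<exists>A. isometry_onto n S A"
proof -
  note cl = subspace_closed[OF S]
  define V where "V x \<longleftrightarrow> vec n x \<in> S" for x :: "nat \<Rightarrow> complex"
  have V0: "V (\<lambda>m. 0)"
  proof -
    have "vec n (\<lambda>m. 0 :: complex) = 0\<^sub>v n" by auto
    thus ?thesis using cl(2) by (simp add: V_def)
  qed
  have V_add: "V (\<lambda>m. v m + w m)" if "V v" "V w" for v w
  proof -
    have "vec n (\<lambda>m. v m + w m) = vec n v + vec n w" by auto
    thus ?thesis using cl(3) that by (simp add: V_def)
  qed
  have V_scale: "V (\<lambda>m. a * v m)" if "V v" for a v
  proof -
    have "vec n (\<lambda>m. a * v m) = a \<cdot>\<^sub>v vec n v" by auto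
    thus ?thesis using cl(4) that by (simp add: V_def)
  qed
  obtain k :: nat and e where e: "orthonormal n {..<k} e" "\<And>i. i < k \<Longrightarrow> V (e i)"
    and span: "\<And>v m. V v \<Longrightarrow> m < n \<Longrightarrow> v m = comb {..<k} (\<lambda>i. ip n v (e i)) e m"
    using orthonormal_basis_exists[of V n, OF V0 V_add V_scale] by blast
  have closed: "V (comb {..<k} a e)" for a
    by (rule comb_closed) (use V0 V_add V_scale e(2) in auto)
  define A where "A = cols_mat n k e"
  have A: "A \<in> carrier_mat n k" by (simp add: A_def)
  have col: "comb {..<k} x (\<lambda>l m. A $$ (m, l)) i = comb {..<k} x e i" if "i < n" for x i
    using that by (simp add: comb_def A_def cols_mat_def)
  have "orthonormal n {..<k} (\<lambda>i m. A $$ (m, i))"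
    using e(1) by (simp add: orthonormal_def ip_def A_def cols_mat_def)
  hence "mat_adjoint A * A = 1\<^sub>m k" using isometry_iff[OF A] by simp
  moreover have "mat_range A = S"
  proof safe
    fix v assume "v \<in> mat_range A"
    then obtain y where y: "y \<in> carrier_vec k" "v = A *\<^sub>v y" using A by (auto simp: mat_range_def)
    have "v = vec n (comb {..<k} (vec_index y) e)"
      by (rule eq_vecI) (use A y in \<open>simp_all add: mult_mat_vec_index[OF A y(1)] col del: index_mult_mat_vec\<close>)
    thus "v \<in> S" using closed by (simp add: V_def)
  next
    fix v assume v: "v \<in> S"
    hence vc: "v \<in> carrier_vec n" using cl(1) by auto
    have "vec n (vec_index v) = v" using vc by auto
    hence Vv: "V (vec_index v)" using v by (simp add: V_def)
    define y where "y = vec k (\<lambda>i. ip n (vec_index v) (e i))"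
    have y: "y \<in> carrier_vec k" by (simp add: y_def)
    have "v = A *\<^sub>v y"
    proof (rule eq_vecI)
      fix i assume "i < dim_vec (A *\<^sub>v y)"
      hence i: "i < n" using A by simp
      have "vec_index (A *\<^sub>v y) i = comb {..<k} (\<lambda>i. ip n (vec_index v) (e i)) e i"
        unfolding mult_mat_vec_index[OF A y i] col[OF i] by (simp add: comb_def y_def)
      thus "vec_index v i = vec_index (A *\<^sub>v y) i" using span[OF Vv i] by simp
    qed (use A vc in auto)
    thus "v \<in> mat_range A" using A y by (auto simp: mat_range_def)
  qed
  ultimately show ?thesis using A by (auto simp: isometry_onto_def)
qed

lemma isometry_columns_le:
  fixes k k' :: nat
  assumes b: "orthonormal n {..<k'} b" and e: "orthonormal n {..<k} e"
    and y: "\<And>l m. l < k' \<Longrightarrow> m < n \<Longrightarrow> b l m = comb {..<k} (y l) e m"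
  shows "k' \<le> k"
proof -
  have "orthonormal k {..<k'} y" by (rule orthonormal_coords[OF e b]) (simp add: y)
  from orthonormal_weights(3)[OF _ this] show ?thesis by simp
qed

lemma rev_sort_decreasing: "sorted (rev xs) \<Longrightarrow> rev (sort xs) = (xs :: real list)"
  using sorted_list_of_multiset_mset[of xs] sorted_list_of_multiset_mset[of "rev xs"]
  by (simp add: sorted_sort_id)

lemma sum_take_padded:
  assumes "\<And>i. i < k \<Longrightarrow> 0 \<le> f i" "\<And>a b. a \<le> b \<Longrightarrow> b < k \<Longrightarrow> f b \<le> f a" "j \<le> m" "k \<le> m"
  shows "sum_list (take j (rev (sort (pad_zeros m (map f [0..<k]))))) = (\<Sum>i<min j k. f i :: real)"
proof -
  have sr: "sorted (rev (map f [0..<k]))" by (auto simp: sorted_iff_nth_mono rev_nth intro!: assms)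
  have "sorted (rev (pad_zeros m (map f [0..<k])))"
    unfolding pad_zeros_def rev_append sorted_append using sr assms(1) by (auto simp: sorted_replicate)
  hence "sum_list (take j (rev (sort (pad_zeros m (map f [0..<k]))))) = sum_list (take j (pad_zeros m (map f [0..<k])))"
    by (simp only: rev_sort_decreasing)
  also have "\<dots> = sum_list (map f [0..<min j k])"
    by (simp add: pad_zeros_def take_map sum_list_replicate min_def)
  also have "\<dots> = (\<Sum>i<min j k. f i)" by (simp add: interv_sum_list_conv_sum_set_nat atLeast0LessThan)
  finally show ?thesis .
qed

text \<open>
  Partial sums with more than \<open>k\<close> terms need no separate hypothesis: padding leaves
  the left side unchanged, while the right side keeps growing.
\<close>

lemma submajorized_mapI:
  assumes f: "\<And>i. i < k \<Longrightarrow> 0 \<le> f i" "\<And>a b. a \<le> b \<Longrightarrow> b < k \<Longrightarrow> f b \<le> f a"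
    and g: "\<And>i. i < h \<Longrightarrow> 0 \<le> g i" "\<And>a b. a \<le> b \<Longrightarrow> b < h \<Longrightarrow> g b \<le> g a"
    and le: "\<And>j. j \<le> k \<Longrightarrow> (\<Sum>i<j. f i) \<le> (\<Sum>i<min j h. g i)"
  shows "map f [0..<k] \<prec>\<^sub>w map g [0..<h]"
  unfolding submajorized_def Let_def
proof
  fix j assume "j \<in> {1..max (length (map f [0..<k])) (length (map g [0..<h]))}"
  hence j: "j \<le> max k h" by simp
  have "(\<Sum>i<min j k. f i) \<le> (\<Sum>i<min (min j k) h. g i)" by (rule le) simp
  also have "\<dots> \<le> (\<Sum>i<min j h. g i)" by (rule sum_mono2) (auto simp: g)
  finally show "sum_list (take j (rev (sort (pad_zeros (max (length (map f [0..<k])) (length (map g [0..<h]))) (map f [0..<k])))))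
    \<le> sum_list (take j (rev (sort (pad_zeros (max (length (map f [0..<k])) (length (map g [0..<h]))) (map g [0..<h])))))"
    using sum_take_padded[OF f j, of k] sum_take_padded[OF g j, of h] by simp
qed

lemma sing_vals_eq:
  assumes "diagonalizes k x (\<lambda>l. of_real (\<mu> l)) (mat_adjoint C * C)"
    and "\<And>l. l < k \<Longrightarrow> 0 \<le> \<mu> l" "\<And>i j. i \<le> j \<Longrightarrow> j < k \<Longrightarrow> \<mu> j \<le> \<mu> i"
  shows "sing_vals C = map (\<lambda>l. sqrt (\<mu> l)) [0..<k]"
  unfolding sing_vals_def
  by (rule eigvals_desc_eq[OF diagonalizes_mat_sqrt]) (use assms in auto)

text \<open>
  The isometries onto \<open>S\<close> and \<open>T\<close> are chosen independently of each
  other. In eigencoordinates of \<open>X\<close>, the columns of the second one are images at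
  time \<open>1\<close> of an orthonormal basis \<open>b\<close> of \<open>S\<close>, and for
  \<open>C = A\<^sup>* B\<close> the matrix \<open>C\<^sup>* C\<close> is the Gram matrix of
  \<open>b\<close> at time \<open>1\<close>.
\<close>

theorem theorem2p15:
  fixes n :: nat and S T :: "complex vec set" and X :: "complex mat"
  assumes "VectorSpace.subspace class_ring S (module_vec TYPE(complex) n)"
    and "VectorSpace.subspace class_ring T (module_vec TYPE(complex) n)"
    and "hermitian_mat n X"
    and "(\<lambda>v. mat_exp (\<i> \<cdot>\<^sub>m X) *\<^sub>v v) ` S = T"
  shows "principal_angles n S T \<prec>\<^sub>w map (\<lambda>x. 1 / 2 * x) (spectral_spread X)"
proof -
  obtain q lam where dX: "diagonalizes n q (\<lambda>l. of_real (lam l)) X"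
    and lam: "\<And>a b. a \<le> b \<Longrightarrow> b < n \<Longrightarrow> lam b \<le> lam a"
    using hermitian_diagonalizable_sorted[OF assms(3)] by blast
  have q: "orthonormal n {..<n} q" and X: "X \<in> carrier_mat n n" using dX by (simp_all add: diagonalizes_def)
  define U where "U = mat_exp (\<i> \<cdot>\<^sub>m X)"
  have "diagonalizes n q (\<lambda>l. \<i> * of_real (lam l)) (\<i> \<cdot>\<^sub>m X)"
    using dX X by (simp add: diagonalizes_def mult.assoc flip: sum_distrib_left)
  from diagonalizes_exp[OF this] have dU: "diagonalizes n q (\<lambda>l. cis (lam l)) U"
    by (simp add: U_def cis_conv_exp)
  have U: "U \<in> carrier_mat n n" using dU by (simp add: diagonalizes_def)
  define A where "A = (SOME A. isometry_onto n S A)"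
  define B where "B = (SOME B. isometry_onto n T B)"
  have isoA: "isometry_onto n S A" unfolding A_def by (rule someI_ex[OF isometry_onto_exists[OF assms(1)]])
  have isoB: "isometry_onto n T B" unfolding B_def by (rule someI_ex[OF isometry_onto_exists[OF assms(2)]])
  define k where "k = dim_col A"
  define k' where "k' = dim_col B"
  have A: "A \<in> carrier_mat n k" and B: "B \<in> carrier_mat n k'"
    using isoA isoB by (auto simp: isometry_onto_def k_def k'_def)
  have onA: "orthonormal n {..<k} (\<lambda>i m. A $$ (m, i))" and onB: "orthonormal n {..<k'} (\<lambda>i m. B $$ (m, i))"
    using isoA isoB isometry_iff[OF A] isometry_iff[OF B] by (auto simp: isometry_onto_def k_def k'_def)
  \<comment> \<open>coordinates in the eigenbasis of \<open>X\<close>\<close>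
  define hat where "hat x = (\<lambda>m. ip n x (q m))" for x
  have hat_comb: "hat (comb I a c) = comb I a (\<lambda>i. hat (c i))" for I :: "nat set" and a c
    by (simp add: hat_def ip_comb_left comb_def fun_eq_iff)
  have ip_hat: "ip n (hat x) (hat y) = ip n x y" for x y
    unfolding hat_def by (rule parseval[OF q])
  define e where "e i = hat (\<lambda>m. A $$ (m, i))" for i
  define f where "f i = hat (\<lambda>m. B $$ (m, i))" for i
  have onE: "orthonormal n {..<k} e" and onf: "orthonormal n {..<k'} f"
    using onA onB by (simp_all add: orthonormal_def e_def f_def ip_hat)
  interpret rotating_subspace n k lam e by unfold_locales (use onE lam in auto)
  have hat_cong: "hat x = hat x'" if "\<And>m. m < n \<Longrightarrow> x m = x' m" for x x'
    unfolding hat_def using that by (intro ext ip_cong) auto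
  have hat_U: "hat (vec_index (U *\<^sub>v v)) m = evolve 1 (hat (vec_index v)) m" if "v \<in> carrier_vec n" "m < n" for v m
  proof -
    have "hat (vec_index (U *\<^sub>v v)) = hat (comb {..<n} (\<lambda>l. cis (lam l) * ip n (vec_index v) (q l)) q)"
    proof (rule hat_cong)
      fix i assume i: "i < n"
      have "vec_index (U *\<^sub>v v) i = (\<Sum>j<n. U $$ (i, j) * vec_index v j)"
        using U that(1) i by (simp add: scalar_prod_def atLeast0LessThan)
      thus "vec_index (U *\<^sub>v v) i = comb {..<n} (\<lambda>l. cis (lam l) * ip n (vec_index v) (q l)) q i"
        by (simp only: diagonalizes_apply[OF dU i])
    qed
    thus ?thesis using that(2) by (simp add: hat_def evolve_def orthonormal_comb_ip[OF _ q])
  qed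
  have hat_mult: "hat (vec_index (M *\<^sub>v v)) = comb {..<p} (vec_index v) (\<lambda>l. hat (\<lambda>m. M $$ (m, l)))"
    if "M \<in> carrier_mat n p" "v \<in> carrier_vec p" for M v p
    unfolding hat_comb[symmetric] by (rule hat_cong) (rule mult_mat_vec_index[OF that])
  have hat_col: "hat (vec_index (M *\<^sub>v unit_vec p l)) = hat (\<lambda>m. M $$ (m, l))"
    if "M \<in> carrier_mat n p" "l < p" for M p l
    by (rule hat_cong) (use that in \<open>simp add: scalar_prod_def unit_vec_def if_distrib[of "\<lambda>z. _ * z"] cong: if_cong\<close>)
  have S_carrier: "S \<subseteq> carrier_vec n" by (rule subspace_closed(1)[OF assms(1)])
  have rangeA: "mat_range A = S" and rangeB: "mat_range B = T" using isoA isoB by (simp_all add: isometry_onto_def)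
  have "\<exists>y. \<forall>m<n. f l m = evolve 1 (comb {..<k} y e) m" if l: "l < k'" for l
  proof -
    have "B *\<^sub>v unit_vec k' l \<in> T" using B unfolding rangeB[symmetric] mat_range_def by auto
    then obtain s where s: "s \<in> S" "B *\<^sub>v unit_vec k' l = U *\<^sub>v s" using assms(4) unfolding U_def by auto
    then obtain y where y: "y \<in> carrier_vec k" "s = A *\<^sub>v y"
      using A unfolding rangeA[symmetric] mat_range_def by auto
    have "f l = hat (vec_index (U *\<^sub>v s))" using hat_col[OF B l] s(2) by (simp add: f_def)
    moreover have "hat (vec_index s) = comb {..<k} (vec_index y) e"
      unfolding y(2) hat_mult[OF A y(1)] e_def ..
    ultimately have "\<forall>m<n. f l m = evolve 1 (comb {..<k} (vec_index y) e) m"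
      using hat_U[of s] s(1) S_carrier by auto
    thus ?thesis by blast
  qed
  then obtain y where y: "\<And>l m. l < k' \<Longrightarrow> m < n \<Longrightarrow> f l m = evolve 1 (comb {..<k} (y l) e) m" by metis
  have "\<exists>z. \<forall>m<n. evolve 1 (e l) m = comb {..<k'} z f m" if l: "l < k" for l
  proof -
    define s where "s = A *\<^sub>v unit_vec k l"
    have s: "s \<in> S" using A unfolding rangeA[symmetric] mat_range_def s_def by auto
    hence "U *\<^sub>v s \<in> T" using assms(4) unfolding U_def by auto
    then obtain z where z: "z \<in> carrier_vec k'" "U *\<^sub>v s = B *\<^sub>v z"
      using B unfolding rangeB[symmetric] mat_range_def by auto
    have "hat (vec_index (U *\<^sub>v s)) = comb {..<k'} (vec_index z) f"
      unfolding z(2) hat_mult[OF B z(1)] f_def ..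
    moreover have "hat (vec_index s) = e l" unfolding s_def e_def by (rule hat_col[OF A l])
    ultimately have "\<forall>m<n. evolve 1 (e l) m = comb {..<k'} (vec_index z) f m"
      using hat_U[of s] s S_carrier by auto
    thus ?thesis by blast
  qed
  then obtain z where z: "\<And>l m. l < k \<Longrightarrow> m < n \<Longrightarrow> evolve 1 (e l) m = comb {..<k'} (z l) f m" by metis
  have onue: "orthonormal n {..<k} (\<lambda>i. evolve 1 (e i))" using onE by (simp add: orthonormal_def)
  have "k' \<le> k" by (rule isometry_columns_le[OF onf onue]) (simp add: y evolve_comb)
  moreover have "k \<le> k'" by (rule isometry_columns_le[OF onue onf]) (simp add: z)
  \<comment> \<open>both isometries have as many columns as the common dimension of \<open>S\<close> and \<open>T\<close>\<close>
  ultimately have kk: "k' = k" by simp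
  define b where "b l = comb {..<k} (y l) e" for l
  have ub: "evolve 1 (b l) m = f l m" if "l < k" "m < n" for l m using y[of l m] that kk by (simp add: b_def)
  have proj_b: "\<forall>i<k. proj (b i) = b i"
    unfolding b_def proj_comb by (simp add: comb_def fun_eq_iff proj_basis)
  have onb: "orthonormal n {..<k} b"
    unfolding orthonormal_def
  proof (intro ballI)
    fix l l' assume l: "l \<in> {..<k}" "l' \<in> {..<k}"
    have "ip n (b l) (b l') = ip n (evolve 1 (b l)) (evolve 1 (b l'))" by simp
    also have "\<dots> = ip n (f l) (f l')" using l by (intro ip_cong ub) auto
    finally show "ip n (b l) (b l') = (if l = l' then 1 else 0)" using l kk by (simp add: orthonormal_ip[OF onf])
  qed
  define C where "C = mat_adjoint A * B"
  have C: "C \<in> carrier_mat k k" using mult_carrier_mat[OF mat_adjoint_carrier[OF A] B] kk by (simp add: C_def)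
  have C_index: "C $$ (i, l) = ip n (f l) (e i)" if "i < k" "l < k" for i l
    using adjoint_mult_index[OF A B that(1)] that(2) kk by (simp add: C_def f_def e_def ip_hat)
  have gram: "mat_adjoint C * C = gram 1 b"
  proof (rule eq_matI)
    fix l l' assume "l < dim_row (gram 1 b)" "l' < dim_col (gram 1 b)"
    hence l: "l < k" "l' < k" by (simp_all add: gram_def)
    have "gram 1 b $$ (l, l') = ip n (proj (evolve 1 (b l'))) (evolve 1 (b l))"
      using l by (simp add: gram_def ip_proj_right)
    also have "\<dots> = (\<Sum>i<k. ip n (evolve 1 (b l')) (e i) * ip n (e i) (evolve 1 (b l)))" by (rule ip_proj_left)
    also have "\<dots> = (\<Sum>i<k. ip n (f l') (e i) * ip n (e i) (f l))"
      using l by (intro sum.cong refl arg_cong2[of _ _ _ _ "(*)"] ip_cong ub) auto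
    also have "\<dots> = (mat_adjoint C * C) $$ (l, l')"
      unfolding adjoint_mult_index[OF C C l] ip_def[of k]
      by (intro sum.cong refl) (simp add: C_index l ip_cnj)
    finally show "(mat_adjoint C * C) $$ (l, l') = gram 1 b $$ (l, l')" ..
  qed (use C carrier_matD[OF mat_adjoint_carrier[OF C]] in \<open>simp_all add: gram_def\<close>)
  obtain x \<mu> where d: "diagonalizes k x (\<lambda>l. of_real (\<mu> l)) (gram 1 b)"
    and anti: "\<And>i j. i \<le> j \<Longrightarrow> j < k \<Longrightarrow> \<mu> j \<le> \<mu> i"
    using hermitian_diagonalizable_sorted[OF hermitian_gram[of 1 b]] by blast
  define \<theta> where "\<theta> l = arccos (sqrt (\<mu> (k - 1 - l)))" for l
  obtain a where pr: "principal 1 \<theta> a"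
    using principal_gram[OF onb proj_b d anti] unfolding \<theta>_def by blast
  have "sing_vals C = map (\<lambda>l. sqrt (\<mu> l)) [0..<k]"
    by (rule sing_vals_eq[of _ x]) (use d anti gram_eigenvectors(4)[OF onb proj_b d] in \<open>simp_all add: gram\<close>)
  hence angles: "principal_angles n S T = map \<theta> [0..<k]"
    unfolding principal_angles_def Let_def A_def[symmetric] B_def[symmetric] C_def[symmetric]
    by (intro nth_equalityI) (simp_all add: rev_nth \<theta>_def)
  have spread: "map (\<lambda>x. 1 / 2 * x) (spectral_spread X) = map (\<lambda>i. (lam i - lam (n - 1 - i)) / 2) [0..<n div 2]"
    using eigvals_desc_eq[OF dX lam] X by (auto simp: spectral_spread_def Let_def)
  show ?thesis
    unfolding angles spread
  proof (rule submajorized_mapI)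
    fix j assume "j \<le> k"
    thus "(\<Sum>i<j. \<theta> i) \<le> (\<Sum>i<min j (n div 2). (lam i - lam (n - 1 - i)) / 2)"
      using top_angle_sum_le[OF onb proj_b d anti] by (simp add: \<theta>_def half_spread_sum_def)
  next
    fix i assume "i < n div 2"
    thus "0 \<le> (lam i - lam (n - 1 - i)) / 2" using lam[of i "n - 1 - i"] by simp
  next
    fix i j assume "i \<le> j" "j < n div 2"
    hence "lam j \<le> lam i" "lam (n - 1 - i) \<le> lam (n - 1 - j)" by (auto intro!: lam)
    thus "(lam j - lam (n - 1 - j)) / 2 \<le> (lam i - lam (n - 1 - i)) / 2"
      by (rule divide_right_mono[OF diff_mono]) simp
  qed (use principalD(3,5)[OF pr] in auto)
qed

end
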